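(* Let $a>0$ be real and $b\in\mathbb{C}$. For real $x>0$ the following asymptotic expansions hold as $x\to0^{+}$. (i) If $b\neq 1+an$ for all integers $n\ge 0$, then $$\sum_{n=1}^{\infty}\frac{e^{-n^{a}x}}{n^{b}}\sim\frac{x^{\frac{b-1}{a}}}{a}\Gamma\left(\frac{1-b}{a}\right)+\sum_{n=0}^{\infty}\frac{(-x)^{n}}{n!}\zeta(b-an),$$ that is, for every integer $N\ge 0$, the left side minus the expression obtained from the right side by restricting the last sum to $0\le n\le N$ is $o(x^{N})$ as $x\to0^{+}$. (ii) If there is an integer $n_{0}\ge 0$ such that $b=1+an_{0}$, then $$\sum_{n=1}^{\infty}\frac{e^{-n^{a}x}}{n^{b}}\sim\frac{(-x)^{n_{0}}\left(\gamma a+\psi(n_{0}+1)-\log x\right)}{a\,n_{0}!}+\sum_{\substack{n\ge 0\\ n\neq n_{0}}}\frac{(-x)^{n}}{n!}\zeta(b-an),$$ that is, for every integer $N\ge 0$, the left side minus the expression obtained from the right side by restricting the last sum to $0\le n\le N$, $n\ne n_0$ (the first term being always kept), is $o(x^{N})$ as $x\to0^{+}$.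
   Context: $\Gamma$ is the Euler gamma function (meromorphically continued), $\psi=\Gamma'/\Gamma$ is the digamma function, $\gamma=-\psi(1)$ is Euler's constant, and $\zeta$ is the meromorphic continuation of the Riemann zeta function. Powers $n^{b}$ and $x^{w}$ of positive reals are $e^{b\log n}$ and $e^{w\log x}$ with real logarithm. *)

theory Defs
  imports "HOL-Complex_Analysis.Complex_Analysis" "HOL-Library.Landau_Symbols"
begin

(* A nicely meromorphic function takes the value 0 at its poles and has no removable
   discontinuities. With this normalisation the meromorphic continuation to the whole plane
   is unique as a total function, in particular riemann_zeta 1 = 0. *)
definition riemann_zeta :: "complex \<Rightarrow> complex" where
  "riemann_zeta = (THE f. f nicely_meromorphic_on UNIV \<and>
     (\<forall>s. Re s > 1 \<longrightarrow> f s = (\<Sum>n. 1 / of_nat (Suc n) powr s)))"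

(* The series over n >= 1 is indexed by Suc n. It converges for all a > 0 and x > 0. *)
definition exp_dirichlet_series :: "real \<Rightarrow> complex \<Rightarrow> real \<Rightarrow> complex" where
  "exp_dirichlet_series a b x =
     (\<Sum>n. complex_of_real (exp (- (real (Suc n) powr a) * x)) / of_nat (Suc n) powr b)"

end

theory Submission
  imports Defs "HOL-Real_Asymp.Real_Asymp"
begin

text \<open>
  Put \<open>w = 1 - b\<close>. Integrating the power series of \<open>exp (- x * t powr a)\<close> termwise gives a primitive
  \<open>F\<close> of the summand \<open>t powr (w - 1) * exp (- x * t powr a)\<close> as a series in the primitives of the powers
  \<open>t powr (w + a * n - 1)\<close>, up to a constant \<open>- c x\<close> which is fixed by \<open>F \<longlongrightarrow> 0\<close> at infinity. The constant
  \<open>c x\<close> is the limit of a lower incomplete gamma function and yields the leading term. Euler--Maclaurin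
  summation is linear, assigns to a single power the value \<open>\<zeta> (1 - w - a * n)\<close>
  (or \<open>\<gamma>\<close> for \<open>1 / t\<close>), and bounds the tail \<open>n > N\<close> of the series by \<open>x ^ (N + 1)\<close>: on the tail,
  a derivative of sufficiently high order is dominated by \<open>x ^ (N + 1)\<close> times a summable power of \<open>t\<close>.
\<close>

text \<open>For \<open>a > 1\<close> the full series of the terms
  \<open>(- x) ^ n / fact n * zeta (b - a * n)\<close> diverges in general, so the two summations
  cannot be interchanged and only finitely many powers can be split off. What is left grows
  polynomially in t; differentiation makes it summable, since K derivatives lower the exponent by K.
  The delicate point is a bound by x^(N+1) that is uniform in t, for small and for large
  \<open>u = x * t powr a\<close>. It rests on the fact that every derivative of the summand is a
  power of t times a polynomial in u times exp(-u).

  The second obstacle is resonance: if w + a*n = 0 for some n, the primitive of that power is a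
  logarithm. Both cases of the theorem run through the same formulas, because the logarithm carries
  the coefficient \<open>gamma_res\<close>, which vanishes off the poles of Gamma. In case (ii) the
  finite part of Gamma at a pole is needed. The recursion reduces it to a single unknown limit L at
  s = 0; the expansion is proved with L as a parameter, and one instance of it then determines
  L.\<close>

subsection \<open>Euler--Maclaurin summation\<close>

text \<open>The Taylor coefficients \<open>B\<^sub>j / j!\<close> of \<open>t / (exp t - 1)\<close>.\<close>
definition em_coeff :: "nat \<Rightarrow> complex" where
  "em_coeff = fps_nth (inverse (Abs_fps (\<lambda>n. 1 / fact (Suc n))))"

text \<open>Coefficient of t^m in \<open>inverse ?E * ?E = 1\<close> for E(t) = (exp t - 1) / t;
  this is the Bernoulli recursion.\<close>

lemma em_coeff_conv:
  "(\<Sum>j\<le>m. em_coeff j / fact (Suc (m - j))) = (if m = 0 then 1 else 0)"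
proof -
  let ?E = "Abs_fps (\<lambda>n. 1 / fact (Suc n)) :: complex fps"
  have "inverse ?E * ?E = 1"
    by (rule inverse_mult_eq_1) simp
  hence "fps_nth (inverse ?E * ?E) m = (if m = 0 then 1 else 0)"
    by simp
  thus ?thesis
    by (simp add: fps_mult_nth em_coeff_def atLeast0AtMost del: fact_Suc)
qed

lemma em_coeff_0 [simp]: "em_coeff 0 = 1"
  using em_coeff_conv[of 0] by simp

text \<open>A function is given together with its derivatives as a family \<open>F\<close>: the summand is \<open>F 1\<close>,
  and \<open>F 0\<close> is a primitive of it.\<close>
definition em_rest :: "nat \<Rightarrow> (nat \<Rightarrow> complex \<Rightarrow> complex) \<Rightarrow> nat \<Rightarrow> complex" where
  "em_rest K F n = F 1 (of_nat n) - (\<Sum>j<K. em_coeff j * (F j (of_nat (Suc n)) - F j (of_nat n)))"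

text \<open>The regularised value of the sum of \<open>F 1 n\<close> over n >= 1. The second sum is
  the lower end of the telescoping differences. Since \<open>em_coeff 0 = 1\<close>, adding a
  constant q to the primitive \<open>F 0\<close> changes the value by -q.\<close>

definition em_const :: "nat \<Rightarrow> (nat \<Rightarrow> complex \<Rightarrow> complex) \<Rightarrow> complex" where
  "em_const K F = (\<Sum>n. em_rest K F (Suc n)) - (\<Sum>j<K. em_coeff j * F j 1)"

definition em_bound :: "nat \<Rightarrow> real" where
  "em_bound K = (\<Sum>j<K. norm (em_coeff j))"

definition em_smooth :: "(nat \<Rightarrow> complex \<Rightarrow> complex) \<Rightarrow> bool" where
  "em_smooth F \<longleftrightarrow> (\<forall>j z. Re z > 0 \<longrightarrow> (F j has_field_derivative F (Suc j) z) (at z))"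

text \<open>Expand each \<open>F j (n + 1) - F j n\<close> by Taylor's formula; the convolution identity
  \<open>em_coeff_conv\<close> cancels every derivative except \<open>F 1\<close>.\<close>
lemma em_rest_bound:
  assumes F: "em_smooth F" and n: "n > 0" and K: "K > 0"
    and B: "\<And>t. real n \<le> t \<Longrightarrow> t \<le> real n + 1 \<Longrightarrow> norm (F (Suc K) (of_real t)) \<le> B"
  shows "norm (em_rest K F n) \<le> em_bound K * B"
proof -
  let ?p = "of_nat n :: complex"
  define S where "S = complex_of_real ` {real n..real n + 1}"
  have S: "convex S"
    unfolding S_def by (intro convex_linear_image convex_real_interval) (auto simp: linear_iff scaleR_conv_of_real)
  have "complex_of_real (real n) \<in> S" "complex_of_real (real n + 1) \<in> S"
    unfolding S_def by (rule imageI, simp)+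
  hence pS: "?p \<in> S" "?p + 1 \<in> S"
    by simp_all
  have ReS: "Re z > 0" if "z \<in> S" for z
    using that n by (auto simp: S_def)
  have B0: "B \<ge> 0"
    using B[of "real n"] by (smt (verit) norm_ge_zero)
  \<comment> \<open>The expansion of \<open>F j\<close> stops at order K - j, so that for every j
    the remainder involves the same derivative \<open>F (Suc K)\<close>.\<close>
  define err where
    "err j = F j (?p + 1) - F j ?p - (\<Sum>i<K-j. F (j + Suc i) ?p / fact (Suc i))" for j
  have err: "norm (err j) \<le> B" if "j < K" for j
  proof -
    have "norm (F (j + 0) (?p + 1) - (\<Sum>i\<le>K-j. F (j + i) ?p * (?p + 1 - ?p) ^ i / fact i))
        \<le> B * norm (?p + 1 - ?p) ^ Suc (K - j) / fact (K - j)"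
    proof (rule complex_Taylor[OF S, of "K - j" "\<lambda>i. F (j + i)"])
      fix i x assume "x \<in> S"
      thus "(F (j + i) has_field_derivative F (j + Suc i) x) (at x within S)"
        using F ReS unfolding em_smooth_def by (metis add_Suc_right has_field_derivative_at_within)
    next
      fix x assume "x \<in> S"
      thus "cmod (F (j + Suc (K - j)) x) \<le> B"
        using B that by (auto simp: S_def)
    qed (use pS in auto)
    also have "\<dots> \<le> B"
      using B0 by (simp add: divide_le_eq mult_left_mono[of 1 "fact (K-j)" B, simplified])
    also have "(\<Sum>i\<le>K-j. F (j + i) ?p * (?p + 1 - ?p) ^ i / fact i)
        = F j ?p + (\<Sum>i<K-j. F (j + Suc i) ?p / fact (Suc i))"
      by (subst sum.atMost_shift) simp
    finally show ?thesis
      by (simp add: err_def algebra_simps)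
  qed
  have "(\<Sum>j<K. em_coeff j * (\<Sum>i<K-j. F (j + Suc i) ?p / fact (Suc i)))
      = (\<Sum>(j,i)\<in>{(j,i). j + i < K}. em_coeff j * F (j + Suc i) ?p / fact (Suc i))"
  proof -
    have "(\<Sum>j<K. em_coeff j * (\<Sum>i<K-j. F (j + Suc i) ?p / fact (Suc i)))
      = (\<Sum>(j,i)\<in>(SIGMA j:{..<K}. {..<K-j}). em_coeff j * F (j + Suc i) ?p / fact (Suc i))"
      by (subst sum.Sigma [symmetric]) (auto simp: sum_distrib_left)
    also have "(SIGMA j:{..<K}. {..<K-j}) = {(j,i). j + i < K}"
      by auto
    finally show ?thesis .
  qed
  also have "\<dots> = (\<Sum>m<K. \<Sum>j\<le>m. em_coeff j * F (j + Suc (m - j)) ?p / fact (Suc (m - j)))"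
    by (rule sum.triangle_reindex)
  also have "\<dots> = (\<Sum>m<K. F (Suc m) ?p * (\<Sum>j\<le>m. em_coeff j / fact (Suc (m - j))))"
    by (intro sum.cong refl) (auto simp: sum_distrib_left mult_ac intro!: sum.cong simp del: fact_Suc)
  also have "\<dots> = F 1 ?p"
    using K by (subst em_coeff_conv) (simp add: if_distrib cong: if_cong)
  finally have main: "(\<Sum>j<K. em_coeff j * (\<Sum>i<K-j. F (j + Suc i) ?p / fact (Suc i))) = F 1 ?p" .
  have "em_rest K F n = - (\<Sum>j<K. em_coeff j * err j)"
    unfolding em_rest_def err_def main[symmetric]
    by (simp add: algebra_simps sum.distrib sum_subtractf)
  hence "norm (em_rest K F n) \<le> (\<Sum>j<K. norm (em_coeff j) * B)"
    using err by (auto intro!: sum_norm_le simp: norm_mult mult_left_mono)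
  thus ?thesis
    by (simp add: em_bound_def sum_distrib_right)
qed

lemma em_telescope:
  "(\<Sum>k<T. em_rest K F (Suc k))
     = (\<Sum>k<T. F 1 (of_nat (Suc k))) - (\<Sum>j<K. em_coeff j * (F j (of_nat (Suc T)) - F j 1))"
proof (induction T)
  case (Suc T)
  have "(\<Sum>k<Suc T. em_rest K F (Suc k)) = (\<Sum>k<T. em_rest K F (Suc k)) + em_rest K F (Suc T)"
    by simp
  also note Suc.IH
  also note em_rest_def
  finally show ?case
    by (simp add: algebra_simps sum.distrib sum_subtractf)
qed auto

text \<open>This limit identifies \<open>em_const\<close> in concrete cases: only the behaviour of
  the \<open>F j\<close> at infinity has to be known.\<close>

lemma em_const_LIMSEQ:
  assumes "summable (\<lambda>n. em_rest K F (Suc n))"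
  shows "(\<lambda>T. (\<Sum>k<T. F 1 (of_nat (Suc k))) - (\<Sum>j<K. em_coeff j * F j (of_nat (Suc T))))
           \<longlonglongrightarrow> em_const K F"
proof -
  have "(\<lambda>T. (\<Sum>k<T. em_rest K F (Suc k)) - (\<Sum>j<K. em_coeff j * F j 1)) \<longlonglongrightarrow> em_const K F"
    unfolding em_const_def using summable_LIMSEQ[OF assms] by (intro tendsto_intros)
  also have "(\<lambda>T. (\<Sum>k<T. em_rest K F (Suc k)) - (\<Sum>j<K. em_coeff j * F j 1)) =
     (\<lambda>T. (\<Sum>k<T. F 1 (of_nat (Suc k))) - (\<Sum>j<K. em_coeff j * F j (of_nat (Suc T))))"
    by (rule ext) (simp only: em_telescope, simp add: algebra_simps sum.distrib sum_subtractf)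
  finally show ?thesis .
qed

section \<open>Linearity of the regularised sum\<close>

lemma em_rest_add: "em_rest K (\<lambda>j z. F j z + G j z) n = em_rest K F n + em_rest K G n"
  by (simp add: em_rest_def algebra_simps sum.distrib sum_subtractf)

lemma em_rest_cmult: "em_rest K (\<lambda>j z. c * F j z) n = c * em_rest K F n"
  by (simp add: em_rest_def algebra_simps sum_distrib_left)

lemma em_const_add:
  assumes "summable (\<lambda>n. em_rest K F (Suc n))" "summable (\<lambda>n. em_rest K G (Suc n))"
  shows "em_const K (\<lambda>j z. F j z + G j z) = em_const K F + em_const K G"
  using assms by (simp add: em_const_def em_rest_add suminf_add [symmetric] algebra_simps sum.distrib)

lemma em_const_cmult:
  assumes "summable (\<lambda>n. em_rest K F (Suc n))"
  shows "em_const K (\<lambda>j z. c * F j z) = c * em_const K F"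
  using assms by (simp add: em_const_def em_rest_cmult suminf_mult algebra_simps sum_distrib_left)

lemma em_rest_sum:
  "finite A \<Longrightarrow> em_rest K (\<lambda>j z. \<Sum>i\<in>A. F i j z) n = (\<Sum>i\<in>A. em_rest K (F i) n)"
proof (induction rule: finite_induct)
  case empty show ?case by (simp add: em_rest_def)
next
  case (insert i A) thus ?case by (simp add: em_rest_add)
qed

lemma em_const_sum:
  assumes "finite A" "\<And>i. i \<in> A \<Longrightarrow> summable (\<lambda>n. em_rest K (F i) (Suc n))"
  shows "em_const K (\<lambda>j z. \<Sum>i\<in>A. F i j z) = (\<Sum>i\<in>A. em_const K (F i))"
  using assms
proof (induction rule: finite_induct)
  case empty show ?case by (simp add: em_const_def em_rest_def)
next
  case (insert i A)
  thus ?case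
    by (simp add: em_const_add em_rest_sum summable_sum)
qed

subsection \<open>Powers and their derivatives\<close>

lemma norm_of_real_powr:
  "t > 0 \<Longrightarrow> norm (complex_of_real t powr w) = t powr Re w"
  by (simp add: norm_powr_real_powr)

lemma em_rest_powr_bound:
  assumes F: "em_smooth F" and K: "K > 0" and \<alpha>: "\<alpha> \<le> 0" and n: "n > 0"
    and B: "\<And>t. t \<ge> 1 \<Longrightarrow> norm (F (Suc K) (of_real t)) \<le> B * t powr \<alpha>"
  shows "norm (em_rest K F n) \<le> em_bound K * (B * real n powr \<alpha>)"
proof (rule em_rest_bound[OF F n K])
  fix t assume t: "real n \<le> t" "t \<le> real n + 1"
  have "0 \<le> norm (F (Suc K) (of_real 1))" by simp
  also have "\<dots> \<le> B" using B[of 1] by simp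
  finally have "B * t powr \<alpha> \<le> B * real n powr \<alpha>"
    using t n \<alpha> by (intro mult_left_mono powr_mono2') auto
  thus "cmod (F (Suc K) (complex_of_real t)) \<le> B * real n powr \<alpha>"
    using B[of t] t n by linarith
qed

lemma summable_Suc_powr: "\<alpha> < -1 \<Longrightarrow> summable (\<lambda>n. real (Suc n) powr \<alpha>)"
  by (subst summable_Suc_iff) (simp add: summable_real_powr_iff)

text \<open>The second bound is linear in B; with B proportional to x^(N+1) it becomes the error
  term of the expansion.\<close>

lemma em_rest_summable:
  assumes F: "em_smooth F" and K: "K > 0" and \<alpha>: "\<alpha> < -1"
    and B: "\<And>t. t \<ge> 1 \<Longrightarrow> norm (F (Suc K) (of_real t)) \<le> B * t powr \<alpha>"
  shows "summable (\<lambda>n. em_rest K F (Suc n))"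
    and "norm (\<Sum>n. em_rest K F (Suc n)) \<le> em_bound K * B * (\<Sum>n. real (Suc n) powr \<alpha>)"
proof -
  have b: "norm (em_rest K F (Suc n)) \<le> em_bound K * B * real (Suc n) powr \<alpha>" for n
    using em_rest_powr_bound[OF F K _ _ B, of "Suc n"] \<alpha> by (simp add: mult_ac)
  have s: "summable (\<lambda>n. em_bound K * B * real (Suc n) powr \<alpha>)"
    by (intro summable_mult summable_Suc_powr \<alpha>)
  have "summable (\<lambda>n. norm (em_rest K F (Suc n)))"
    by (rule summable_comparison_test'[OF s, of 0]) (use b in auto)
  thus "summable (\<lambda>n. em_rest K F (Suc n))"
    by (rule summable_norm_cancel)
  have "norm (\<Sum>n. em_rest K F (Suc n)) \<le> (\<Sum>n. em_bound K * B * real (Suc n) powr \<alpha>)"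
    by (rule norm_suminf_le) (use b s in auto)
  thus "norm (\<Sum>n. em_rest K F (Suc n)) \<le> em_bound K * B * (\<Sum>n. real (Suc n) powr \<alpha>)"
    using summable_Suc_powr[OF \<alpha>] by (simp add: suminf_mult)
qed

text \<open>For \<open>j \<ge> 1\<close> this is the \<open>(j-1)\<close>-st derivative of \<open>z powr (w - 1)\<close>, for \<open>j = 0\<close> a primitive.\<close>
definition pw :: "complex \<Rightarrow> nat \<Rightarrow> complex \<Rightarrow> complex" where
  "pw w j z = (if j = 0 then (if w = 0 then Ln z else z powr w / w)
     else (\<Prod>i\<in>{1..<j}. w - of_nat i) * z powr (w - of_nat j))"

lemma em_smooth_pw: "em_smooth (pw w)"
  unfolding em_smooth_def
proof (intro allI impI)
  fix j z assume z: "Re z > 0"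
  hence nz: "z \<notin> \<real>\<^sub>\<le>\<^sub>0" "z \<noteq> 0"
    by (auto simp: complex_nonpos_Reals_iff)
  show "(pw w j has_field_derivative pw w (Suc j) z) (at z)"
  proof (cases "j = 0")
    case True
    show ?thesis
    proof (cases "w = 0")
      case True
      have "(Ln has_field_derivative z powr (-1)) (at z)"
        using nz by (auto intro!: derivative_eq_intros simp: powr_minus)
      thus ?thesis using True \<open>j = 0\<close>
        by (simp add: pw_def[abs_def])
    next
      case w: False
      have "((\<lambda>z. z powr w / w) has_field_derivative z powr (w - 1)) (at z)"
        using nz w by (auto intro!: derivative_eq_intros)
      thus ?thesis using w True by (simp add: pw_def[abs_def])
    qed
  next
    case False
    have "((\<lambda>z. (\<Prod>i\<in>{1..<j}. w - of_nat i) * z powr (w - of_nat j)) has_field_derivative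
            (\<Prod>i\<in>{1..<j}. w - of_nat i) * ((w - of_nat j) * z powr (w - of_nat j - 1))) (at z)"
      using nz by (auto intro!: derivative_eq_intros)
    thus ?thesis using False
      by (simp add: pw_def[abs_def] diff_diff_eq add.commute mult_ac)
  qed
qed

lemma norm_pw:
  assumes "t > 0" "j > 0"
  shows "norm (pw w j (of_real t)) = norm (\<Prod>i\<in>{1..<j}. w - of_nat i) * t powr (Re w - real j)"
  using assms by (simp add: pw_def norm_mult norm_of_real_powr)

lemma em_rest_pw_summable:
  assumes "K > 0" "Re w < K"
  shows "summable (\<lambda>n. em_rest K (pw w) (Suc n))"
proof (rule em_rest_summable(1)[OF em_smooth_pw \<open>K > 0\<close>])
  show "Re w - real (Suc K) < -1" using assms by simp
  fix t :: real assume "t \<ge> 1"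
  thus "norm (pw w (Suc K) (of_real t)) \<le> norm (\<Prod>i\<in>{1..<Suc K}. w - of_nat i) * t powr (Re w - real (Suc K))"
    by (subst norm_pw) auto
qed

subsection \<open>The zeta function\<close>

text \<open>The difference vanishes near a point of \<open>A\<close>, hence off a sparse set. So
  around every point f and g agree on a punctured neighbourhood and share poles and limits; the
  normalisation then fixes the value at the point itself.\<close>

lemma nicely_meromorphic_on_unique:
  assumes f: "f nicely_meromorphic_on UNIV" and g: "g nicely_meromorphic_on UNIV"
    and A: "open A" "A \<noteq> {}" and eq: "\<And>z. z \<in> A \<Longrightarrow> f z = g z"
  shows "f = g"
proof
  fix z
  have mero: "(\<lambda>z. f z - g z) meromorphic_on UNIV"
    using f g by (auto simp: nicely_meromorphic_on_def intro!: meromorphic_intros)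
  obtain z0 where z0: "z0 \<in> A" using A by auto
  have "eventually (\<lambda>z. z \<in> A) (at z0)"
    using A z0 by (intro eventually_at_in_open') auto
  hence ev0: "eventually (\<lambda>z. f z - g z = 0) (at z0)"
    by eventually_elim (use eq in auto)
  have "eventually (\<lambda>z. f z - g z = 0) (cosparse UNIV)"
  proof (rule ccontr)
    assume "\<not> ?thesis"
    hence "eventually (\<lambda>z. f z - g z \<noteq> 0) (cosparse UNIV)"
      using meromorphic_imp_constant_or_avoid[OF mero, of 0] by auto
    hence "eventually (\<lambda>z. f z - g z \<noteq> 0) (at z0)"
      by (simp add: eventually_cosparse_open_eq)
    with ev0 have "eventually (\<lambda>_. False) (at z0)"
      by eventually_elim auto
    thus False by simp
  qed
  hence ev: "eventually (\<lambda>z. f z = g z) (at z)"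
    by (simp add: eventually_cosparse_open_eq)
  have p: "is_pole f z \<longleftrightarrow> is_pole g z"
    by (intro is_pole_cong ev refl)
  have l: "(f \<longlongrightarrow> c) (at z) \<longleftrightarrow> (g \<longlongrightarrow> c) (at z)" for c
    by (intro tendsto_cong ev)
  show "f z = g z"
  proof (cases "is_pole f z")
    case True
    thus ?thesis
      using f g p by (metis UNIV_I at_neq_bot is_pole_def nicely_meromorphic_on_def not_tendsto_and_filterlim_at_infinity)
  next
    case False
    hence "(f \<longlongrightarrow> f z) (at z)" "(g \<longlongrightarrow> g z) (at z)"
      using f g p by (auto simp: nicely_meromorphic_on_def)
    thus ?thesis
      using l LIM_unique by blast
  qed
qed

text \<open>The regularisation of \<^term>\<open>w * pw w j z\<close> at \<open>w = 0\<close>.\<close>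
definition pww :: "complex \<Rightarrow> nat \<Rightarrow> complex \<Rightarrow> complex" where
  "pww w j z = (if j = 0 then z powr w else w * pw w j z)"

lemma pww_eq: "w \<noteq> 0 \<Longrightarrow> pww w = (\<lambda>j z. w * pw w j z)"
  by (auto simp: fun_eq_iff pww_def pw_def)

lemma em_smooth_pww: "em_smooth (pww w)"
proof (cases "w = 0")
  case False
  thus ?thesis
    using em_smooth_pw[of w] by (auto simp: em_smooth_def pww_eq intro!: DERIV_cmult)
next
  case True
  show ?thesis
    unfolding em_smooth_def
  proof (intro allI impI)
    fix j z assume z: "Re z > 0"
    \<comment> \<open>As \<open>0 powr 0 = 0\<close>, the function \<open>pww 0 0\<close> is
      constantly 1 only away from the origin.\<close>
    have "eventually (\<lambda>z. z \<noteq> 0) (nhds z)"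
      using z by (intro t1_space_nhds) auto
    hence "eventually (\<lambda>z. pww w j z = (if j = 0 then 1 else 0)) (nhds z)"
      by eventually_elim (simp add: True pww_def)
    hence "(pww w j has_field_derivative pww w (Suc j) z) (at z) \<longleftrightarrow>
        ((\<lambda>_. if j = 0 then 1 else 0) has_field_derivative 0) (at z)"
      by (intro DERIV_cong_ev) (simp_all add: True pww_def)
    thus "(pww w j has_field_derivative pww w (Suc j) z) (at z)"
      by simp
  qed
qed

lemma norm_pww:
  assumes "t > 0" "j > 0"
  shows "norm (pww w j (of_real t)) = norm (w * (\<Prod>i\<in>{1..<j}. w - of_nat i)) * t powr (Re w - real j)"
  using assms norm_pw[of t j w] by (simp add: pww_def norm_mult)

lemma pww_holomorphic: "z \<noteq> 0 \<Longrightarrow> (\<lambda>w. pww w j z) holomorphic_on A"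
  unfolding pww_def pw_def by (cases "j = 0") (auto intro!: holomorphic_intros)

lemma em_rest_pww_holomorphic: "(\<lambda>w. em_rest K (pww w) (Suc n)) holomorphic_on A"
  unfolding em_rest_def by (intro holomorphic_intros pww_holomorphic) (simp_all del: of_nat_Suc)

text \<open>The partial sums are entire in w, and the Weierstrass M-test makes them converge locally
  uniformly on the half-plane.\<close>

lemma em_const_pww_holomorphic:
  assumes K: "K > 0"
  shows "(\<lambda>w. em_const K (pww w)) holomorphic_on {w. Re w < real K}"
proof -
  have "(\<lambda>w. \<Sum>n. em_rest K (pww w) (Suc n)) holomorphic_on {w. Re w < real K}"
  proof (rule holomorphic_uniform_sequence[where f = "\<lambda>N w. \<Sum>n<N. em_rest K (pww w) (Suc n)"])
    show "open {w. Re w < real K}" by (rule open_halfspace_Re_lt)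
    show "(\<lambda>w. \<Sum>n<N. em_rest K (pww w) (Suc n)) holomorphic_on {w. Re w < real K}" for N
      by (intro holomorphic_intros em_rest_pww_holomorphic)
    fix w0 assume w0: "w0 \<in> {w. Re w < real K}"
    \<comment> \<open>Half the distance to the line Re w = K, so that one exponent
      \<open>\<alpha> < -1\<close> serves the whole ball.\<close>
    define d where "d = (real K - Re w0) / 2"
    have d: "d > 0" using w0 by (simp add: d_def)
    define \<alpha> where "\<alpha> = Re w0 + d - real K - 1"
    have \<alpha>: "\<alpha> < -1" using w0 by (simp add: \<alpha>_def d_def field_simps)
    have Re_le: "Re w \<le> Re w0 + d" if "w \<in> cball w0 d" for w
      using that abs_Re_le_cmod[of "w - w0"] by (simp add: dist_norm norm_minus_commute)
    let ?q = "\<lambda>w::complex. w * (\<Prod>i\<in>{1..<Suc K}. w - of_nat i)"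
    have "compact (?q ` cball w0 d)"
      by (intro compact_continuous_image continuous_intros) auto
    then obtain B where B: "norm (?q w) \<le> B" if "w \<in> cball w0 d" for w
      by (meson bounded_iff compact_imp_bounded imageI)
    have "uniform_limit (cball w0 d) (\<lambda>N w. \<Sum>n<N. em_rest K (pww w) (Suc n))
            (\<lambda>w. \<Sum>n. em_rest K (pww w) (Suc n)) sequentially"
    proof (rule Weierstrass_m_test)
      show "summable (\<lambda>n. em_bound K * (B * real (Suc n) powr \<alpha>))"
        by (intro summable_mult summable_Suc_powr \<alpha>)
      fix n w assume w: "w \<in> cball w0 d"
      show "norm (em_rest K (pww w) (Suc n)) \<le> em_bound K * (B * real (Suc n) powr \<alpha>)"
      proof (rule em_rest_powr_bound[OF em_smooth_pww K])
        fix t :: real assume t: "t \<ge> 1"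
        have "norm (pww w (Suc K) (of_real t)) = norm (?q w) * t powr (Re w - real (Suc K))"
          using t by (subst norm_pww) auto
        also have "\<dots> \<le> B * t powr \<alpha>"
          using t Re_le[OF w] B[OF w]
          by (intro mult_mono powr_mono order.trans[OF norm_ge_zero B[OF w]]) (auto simp: \<alpha>_def)
        finally show "norm (pww w (Suc K) (of_real t)) \<le> B * t powr \<alpha>" .
      qed (use \<alpha> in auto)
    qed
    moreover have "cball w0 d \<subseteq> {w. Re w < real K}"
      using Re_le \<alpha> by (force simp: \<alpha>_def)
    ultimately show "\<exists>d. 0 < d \<and> cball w0 d \<subseteq> {w. Re w < real K} \<and>
        uniform_limit (cball w0 d) (\<lambda>N w. \<Sum>n<N. em_rest K (pww w) (Suc n))
            (\<lambda>w. \<Sum>n. em_rest K (pww w) (Suc n)) sequentially"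
      using d by blast
  qed
  thus ?thesis
    unfolding em_const_def by (intro holomorphic_intros pww_holomorphic) auto
qed

lemma tendsto_Suc_powr: "\<alpha> < 0 \<Longrightarrow> (\<lambda>T. real (Suc T) powr \<alpha>) \<longlonglongrightarrow> 0"
  by (rule tendsto_neg_powr[OF _ filterlim_compose[OF filterlim_real_sequentially filterlim_Suc]])

lemma tendsto_pw_0:
  assumes "Re w < 0"
  shows "(\<lambda>T. pw w j (of_nat (Suc T))) \<longlonglongrightarrow> 0"
proof -
  have w: "w \<noteq> 0" using assms by auto
  define C where "C = (if j = 0 then inverse (norm w) else norm (\<Prod>i\<in>{1..<j}. w - of_nat i))"
  have "norm (pw w j (of_nat (Suc T))) = C * real (Suc T) powr (Re w - j)" for T
    using norm_of_real_powr[of "real (Suc T)"] w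
    by (auto simp: pw_def C_def norm_mult norm_divide divide_simps simp del: of_nat_Suc)
  moreover have "(\<lambda>T. C * real (Suc T) powr (Re w - j)) \<longlonglongrightarrow> C * 0"
    using assms by (intro tendsto_mult_left tendsto_Suc_powr) auto
  ultimately have "(\<lambda>T. norm (pw w j (of_nat (Suc T)))) \<longlonglongrightarrow> C * 0"
    by (simp only:)
  thus ?thesis
    by (simp only: mult_zero_right tendsto_norm_zero_iff)
qed

text \<open>For Re w < 0 all correction terms, the primitive included, vanish at infinity. The value
  is then the Dirichlet series of zeta at 1 - w.\<close>

lemma em_const_pw_eq_suminf:
  assumes K: "K > 0" and w: "Re w < 0"
  shows "em_const K (pw w) = (\<Sum>n. pw w 1 (of_nat (Suc n)))"
proof -
  have "summable (\<lambda>n. real (Suc n) powr (Re w - 1))"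
    using w by (intro summable_Suc_powr) auto
  also have "(\<lambda>n. real (Suc n) powr (Re w - 1)) = (\<lambda>n. norm (pw w 1 (of_nat (Suc n))))"
    using norm_pw[of "real (Suc n)" 1 w for n] by (simp add: fun_eq_iff)
  finally have "summable (\<lambda>n. pw w 1 (of_nat (Suc n)))"
    by (rule summable_norm_cancel)
  hence "(\<lambda>T. (\<Sum>k<T. pw w 1 (of_nat (Suc k))) - (\<Sum>j<K. em_coeff j * pw w j (of_nat (Suc T))))
     \<longlonglongrightarrow> (\<Sum>n. pw w 1 (of_nat (Suc n))) - (\<Sum>j<K. em_coeff j * 0)"
    by (intro tendsto_intros tendsto_pw_0 w summable_LIMSEQ)
  moreover have "(\<lambda>T. (\<Sum>k<T. pw w 1 (of_nat (Suc k))) - (\<Sum>j<K. em_coeff j * pw w j (of_nat (Suc T))))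
     \<longlonglongrightarrow> em_const K (pw w)"
    using K w by (intro em_const_LIMSEQ em_rest_pw_summable) auto
  ultimately show ?thesis
    using LIMSEQ_unique by fastforce
qed

lemma em_const_pww_eq:
  assumes "K > 0" "w \<noteq> 0" "Re w < real K"
  shows "em_const K (pww w) = w * em_const K (pw w)"
  using assms by (simp add: pww_eq em_const_cmult em_rest_pw_summable)

text \<open>Both sides are analytic on the smaller of the two half-planes and equal w times the
  Dirichlet series for Re w < 0.\<close>

lemma em_const_pww_indep:
  assumes K: "K > 0" "K' > 0" and w: "Re w < real K" "Re w < real K'"
  shows "em_const K (pww w) = em_const K' (pww w)"
proof -
  define S where "S = {w. Re w < real (min K K')}"
  have sub: "S \<subseteq> {w. Re w < real K}" "S \<subseteq> {w. Re w < real K'}"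
    by (auto simp: S_def)
  have convS: "convex S"
    unfolding S_def by (rule convex_halfspace_Re_lt)
  have opS: "open S"
    unfolding S_def by (rule open_halfspace_Re_lt)
  have neg: "{w. Re w < 0} \<subseteq> S"
    using K by (auto simp: S_def)
  have ne: "{w. Re w < 0} \<noteq> {}"
    by (auto intro!: exI[of _ "-1"])
  show ?thesis
  proof (rule analytic_continuation_open[where s = "{w. Re w < 0}" and s' = S and
        f = "\<lambda>w. em_const K (pww w)" and g = "\<lambda>w. em_const K' (pww w)"])
    fix z assume "z \<in> {w. Re w < 0}"
    thus "em_const K (pww z) = em_const K' (pww z)"
      using K by (cases "z = 0") (auto simp: em_const_pww_eq em_const_pw_eq_suminf)
  next
    show "(\<lambda>w. em_const K (pww w)) holomorphic_on S" "(\<lambda>w. em_const K' (pww w)) holomorphic_on S"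
      by (rule holomorphic_on_subset[OF em_const_pww_holomorphic] K sub)+
    show "w \<in> S" using w by (simp add: S_def)
  qed (use opS convex_connected[OF convS] neg ne in \<open>simp_all add: open_halfspace_Re_lt\<close>)
qed

text \<open>The entire function \<open>w * zeta (1 - w)\<close>.\<close>
definition pww_ext :: "complex \<Rightarrow> complex" where
  "pww_ext w = em_const (Suc (nat \<lceil>Re w\<rceil>)) (pww w)"

lemma pww_ext_eq:
  assumes "K > 0" "Re w < real K"
  shows "pww_ext w = em_const K (pww w)"
  unfolding pww_ext_def
proof (rule em_const_pww_indep)
  show "Re w < real (Suc (nat \<lceil>Re w\<rceil>))" by linarith
qed (use assms in auto)

lemma pww_ext_holomorphic:
  assumes "h holomorphic_on A"
  shows "(\<lambda>s. pww_ext (h s)) holomorphic_on A"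
proof -
  have "pww_ext holomorphic_on (\<Union>K\<in>{0<..}. {w. Re w < real K})"
  proof (rule holomorphic_on_UN_open)
    fix K :: nat assume "K \<in> {0<..}"
    thus "pww_ext holomorphic_on {w. Re w < real K}"
      using em_const_pww_holomorphic[of K] pww_ext_eq[of K]
      by (subst holomorphic_cong[OF refl]) auto
  qed (auto simp: open_halfspace_Re_lt)
  moreover have "(\<Union>K\<in>{0<..}. {w. Re w < real K}) = UNIV"
  proof safe
    fix w
    have "Re w < real (Suc (nat \<lceil>Re w\<rceil>))" by linarith
    thus "w \<in> (\<Union>K\<in>{0<..}. {w. Re w < real K})" by blast
  qed auto
  ultimately have "pww_ext holomorphic_on UNIV"
    by simp
  thus ?thesis
    using holomorphic_on_compose_gen[OF assms, of pww_ext UNIV] by (simp add: o_def)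
qed

text \<open>The quotient \<open>pww_ext (1 - s) / (1 - s)\<close> continues the Dirichlet series.
  Applying \<open>remove_sings\<close> gives the normalisation required by
  \<open>riemann_zeta\<close>, without deciding what kind of singularity lies at s = 1; uniqueness
  then evaluates the definite description.\<close>

lemma riemann_zeta_eq_em_const:
  assumes K: "K > 0" and w: "w \<noteq> 0" "Re w < real K"
  shows "riemann_zeta (1 - w) = em_const K (pw w)"
proof -
  define g where "g s = pww_ext (1 - s) / (1 - s)" for s
  define f where "f = remove_sings g"
  have hol: "g holomorphic_on (-{1})"
    unfolding g_def by (intro holomorphic_intros pww_ext_holomorphic) auto
  have an: "g analytic_on {s}" if "s \<noteq> 1" for s
    using hol that by (auto simp: analytic_at intro!: exI[of _ "-{1}"])
  have fg: "f s = g s" if "s \<noteq> 1" for s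
    unfolding f_def using an[OF that] by simp
  have val: "g (1 - w) = em_const K (pw w)" if "K > 0" "w \<noteq> 0" "Re w < real K" for w K
    using that by (simp add: g_def pww_ext_eq em_const_pww_eq)
  have "(\<lambda>s. pww_ext (1 - s)) analytic_on UNIV"
    by (subst analytic_on_open) (auto intro!: holomorphic_intros pww_ext_holomorphic)
  hence "g meromorphic_on UNIV"
    unfolding g_def by (intro meromorphic_intros) (auto intro: analytic_on_imp_meromorphic_on)
  hence f: "f nicely_meromorphic_on UNIV"
    unfolding f_def by (rule remove_sings_nicely_meromorphic)
  have f_ser: "f s = (\<Sum>n. 1 / of_nat (Suc n) powr s)" if s: "Re s > 1" for s
  proof -
    have "s \<noteq> 1" using s by auto
    hence "f s = em_const 1 (pw (1 - s))"
      using val[of 1 "1 - s"] s fg by simp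
    also have "\<dots> = (\<Sum>n. pw (1 - s) 1 (of_nat (Suc n)))"
      using s by (intro em_const_pw_eq_suminf) auto
    also have "\<dots> = (\<Sum>n. 1 / of_nat (Suc n) powr s)"
      by (simp add: pw_def powr_minus_divide)
    finally show ?thesis .
  qed
  have "riemann_zeta = f"
    unfolding riemann_zeta_def
  proof (rule the_equality)
    fix h assume h: "h nicely_meromorphic_on UNIV \<and> (\<forall>s. 1 < Re s \<longrightarrow> h s = (\<Sum>n. 1 / of_nat (Suc n) powr s))"
    show "h = f"
    proof (rule nicely_meromorphic_on_unique)
      show "open {s. Re s > 1}" by (rule open_halfspace_Re_gt)
      show "{s. Re s > 1} \<noteq> {}" by (auto intro!: exI[of _ 2])
    qed (use h f f_ser in auto)
  qed (use f f_ser in auto)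
  thus ?thesis
    using fg[of "1 - w"] val[OF K w] w by simp
qed

text \<open>For w = 0 the primitive is the logarithm, so the regularised partial sums are harmonic
  numbers minus logarithms, up to terms tending to 0.\<close>

lemma euler_mascheroni_eq_em_const:
  assumes K: "K > 0"
  shows "em_const K (pw 0) = euler_mascheroni"
proof -
  have sum: "(\<Sum>k<T. pw 0 1 (of_nat (Suc k))) = of_real (harm T)" for T
  proof (induction T)
    case (Suc T)
    have "(\<Sum>k<Suc T. pw 0 1 (of_nat (Suc k)))
        = complex_of_real (harm T) + pw 0 1 (of_nat (Suc T))"
      by (simp only: sum.lessThan_Suc Suc.IH)
    also have "pw 0 1 (of_nat (Suc T)) = of_real (inverse (real (Suc T)))"
      by (simp add: pw_def powr_minus)
    finally show ?case
      by (simp add: harm_Suc)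
  qed (simp add: harm_def)
  have lim0: "(\<lambda>T. pw 0 j (of_nat (Suc T))) \<longlonglongrightarrow> 0" if "j > 0" for j
  proof -
    define C where "C = norm (\<Prod>i\<in>{1..<j}. (0::complex) - of_nat i)"
    have "norm (pw 0 j (of_nat (Suc T))) = C * real (Suc T) powr (- real j)" for T
      using norm_pw[of "real (Suc T)" j 0] that unfolding C_def by simp
    moreover have "(\<lambda>T. C * real (Suc T) powr (- real j)) \<longlonglongrightarrow> C * 0"
      using that by (intro tendsto_mult_left tendsto_Suc_powr) auto
    ultimately have "(\<lambda>T. norm (pw 0 j (of_nat (Suc T)))) \<longlonglongrightarrow> C * 0"
      by (simp only:)
    thus ?thesis
      by (simp only: mult_zero_right tendsto_norm_zero_iff)
  qed
  \<comment> \<open>The partial sum ends at T but the corrections are taken at T + 1; writing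
    \<open>harm T\<close> as \<open>harm (Suc T)\<close> minus 1 / (T + 1) aligns them.\<close>
  have eq: "(\<Sum>k<T. pw 0 1 (of_nat (Suc k))) - (\<Sum>j<K. em_coeff j * pw 0 j (of_nat (Suc T)))
     = of_real (harm (Suc T) - ln (of_nat (Suc T))) - of_real (inverse (real (Suc T)))
        - (\<Sum>j\<in>{1..<K}. em_coeff j * pw 0 j (of_nat (Suc T)))" for T
  proof -
    have "(\<Sum>j<K. em_coeff j * pw 0 j (of_nat (Suc T)))
        = of_real (ln (real (Suc T))) + (\<Sum>j\<in>{1..<K}. em_coeff j * pw 0 j (of_nat (Suc T)))"
    proof -
      have "{..<K} = insert 0 {1..<K}" using K by auto
      moreover have "pw 0 0 (of_nat (Suc T)) = of_real (ln (real (Suc T)))"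
        using Ln_of_real[of "real (Suc T)"] by (simp add: pw_def)
      ultimately show ?thesis by (simp del: of_nat_Suc)
    qed
    moreover have "of_real (harm (Suc T)) = of_real (harm T) + complex_of_real (inverse (real (Suc T)))"
      by (simp only: harm_Suc of_real_add)
    ultimately show ?thesis
      unfolding sum of_real_diff by (simp only: algebra_simps)
  qed
  have "(\<lambda>T. of_real (harm (Suc T) - ln (of_nat (Suc T))) - of_real (inverse (real (Suc T)))
        - (\<Sum>j\<in>{1..<K}. em_coeff j * pw 0 j (of_nat (Suc T))))
       \<longlonglongrightarrow> euler_mascheroni - complex_of_real 0 - (\<Sum>j\<in>{1..<K}. em_coeff j * 0)"
    by (intro tendsto_intros LIMSEQ_Suc[OF euler_mascheroni_LIMSEQ_of_real] LIMSEQ_inverse_real_of_nat lim0) auto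
  moreover have "(\<lambda>T. (\<Sum>k<T. pw 0 1 (of_nat (Suc k))) - (\<Sum>j<K. em_coeff j * pw 0 j (of_nat (Suc T))))
     \<longlonglongrightarrow> em_const K (pw 0)"
    using K by (intro em_const_LIMSEQ em_rest_pw_summable) auto
  ultimately have "em_const K (pw 0) = euler_mascheroni - complex_of_real 0 - (\<Sum>j\<in>{1..<K}. em_coeff j * 0)"
    unfolding eq by (rule LIMSEQ_unique[rotated])
  thus ?thesis by simp
qed

subsection \<open>Exponentially weighted power series\<close>

text \<open>Chosen because differentiating z^c * eser(x * z^d) only multiplies the coefficients by
  linear factors c + d*n and lowers c by 1, so that all derivatives of the summand stay in one
  class.\<close>

definition eser :: "(nat \<Rightarrow> complex) \<Rightarrow> complex \<Rightarrow> complex" where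
  "eser \<mu> u = (\<Sum>n. \<mu> n * (- u) ^ n / fact n)"

text \<open>Geometric growth makes \<open>eser\<close> entire and survives shifts, linear factors
  and deletion of terms.\<close>

definition exp_bounded :: "(nat \<Rightarrow> complex) \<Rightarrow> bool" where
  "exp_bounded \<mu> \<longleftrightarrow> (\<exists>C r. 0 \<le> r \<and> (\<forall>n. norm (\<mu> n) \<le> C * r ^ n))"

lemma exp_boundedI: "0 \<le> r \<Longrightarrow> (\<And>n. norm (\<mu> n) \<le> C * r ^ n) \<Longrightarrow> exp_bounded \<mu>"
  unfolding exp_bounded_def by blast

lemma exp_bounded_Bseq: "Bseq \<mu> \<Longrightarrow> exp_bounded \<mu>"
  by (elim BseqE, rule exp_boundedI[of 1]) auto

text \<open>The factor n is absorbed by 2^n, which doubles the rate r.\<close>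

lemma exp_bounded_linear:
  assumes "exp_bounded \<mu>"
  shows "exp_bounded (\<lambda>n. (c + d * of_nat n) * \<mu> n)"
proof -
  obtain C r where r: "0 \<le> r" and C: "\<And>n. norm (\<mu> n) \<le> C * r ^ n"
    using assms unfolding exp_bounded_def by blast
  show ?thesis
  proof (rule exp_boundedI)
    fix n
    have "norm (c + d * of_nat n) \<le> norm c + norm d * real n"
      using norm_triangle_ineq[of c "d * of_nat n"] by (simp add: norm_mult)
    also have "\<dots> \<le> norm c * 2 ^ n + norm d * 2 ^ n"
      using of_nat_less_two_power[of n, where 'a = real]
      by (intro add_mono mult_left_mono) (auto simp: mult_le_cancel_left1)
    finally have "norm (c + d * of_nat n) * norm (\<mu> n) \<le> (norm c * 2 ^ n + norm d * 2 ^ n) * (C * r ^ n)"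
      using C by (intro mult_mono) auto
    also have "\<dots> = ((norm c + norm d) * C) * (2 * r) ^ n"
      by (simp add: power_mult_distrib algebra_simps)
    finally show "norm ((c + d * of_nat n) * \<mu> n) \<le> ((norm c + norm d) * C) * (2 * r) ^ n"
      by (simp only: norm_mult)
  qed (use r in auto)
qed

lemma exp_bounded_if:
  assumes "exp_bounded \<mu>"
  shows "exp_bounded (\<lambda>n. if P n then 0 else \<mu> n)"
proof -
  obtain C r where r: "0 \<le> r" and C: "\<And>n. norm (\<mu> n) \<le> C * r ^ n"
    using assms unfolding exp_bounded_def by blast
  show ?thesis
    using C order.trans[OF norm_ge_zero C] by (intro exp_boundedI[OF r]) auto
qed

lemma exp_bounded_const: "exp_bounded (\<lambda>_. c)"
  by (rule exp_bounded_Bseq) simp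

lemma exp_bounded_Suc:
  assumes "exp_bounded \<mu>"
  shows "exp_bounded (\<lambda>n. \<mu> (Suc n))"
proof -
  obtain C r where r: "0 \<le> r" and C: "\<And>n. norm (\<mu> n) \<le> C * r ^ n"
    using assms unfolding exp_bounded_def by blast
  show ?thesis
    using C[of "Suc _"] by (intro exp_boundedI[OF r, of _ "C * r"]) (auto simp: mult_ac)
qed

lemma eser_summable_norm:
  assumes "exp_bounded \<mu>"
  shows "summable (\<lambda>n. norm (\<mu> n * (- u) ^ n / fact n))"
proof -
  obtain C r where r: "0 \<le> r" and C: "\<And>n. norm (\<mu> n) \<le> C * r ^ n"
    using assms unfolding exp_bounded_def by blast
  have "summable (\<lambda>n. C * (inverse (fact n) * (r * norm u) ^ n))"
    by (intro summable_mult summable_exp)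
  thus ?thesis
  proof (rule summable_comparison_test'[of _ 0])
    fix n
    have "norm (\<mu> n) * norm u ^ n / fact n \<le> C * r ^ n * norm u ^ n / fact n"
      by (intro divide_right_mono mult_right_mono C) auto
    thus "norm (norm (\<mu> n * (- u) ^ n / fact n)) \<le> C * (inverse (fact n) * (r * norm u) ^ n)"
      by (simp add: norm_mult norm_divide norm_power power_mult_distrib field_simps)
  qed
qed

lemma eser_summable: "exp_bounded \<mu> \<Longrightarrow> summable (\<lambda>n. \<mu> n * (- u) ^ n / fact n)"
  by (rule summable_norm_cancel[OF eser_summable_norm])

lemma eser_add:
  assumes "exp_bounded \<mu>" "exp_bounded \<nu>"
  shows "eser (\<lambda>n. \<mu> n + \<nu> n) u = eser \<mu> u + eser \<nu> u"
  unfolding eser_def suminf_add[OF eser_summable[OF assms(1)] eser_summable[OF assms(2)]]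
  by (simp only: add_divide_distrib distrib_right)

lemma eser_cmult:
  assumes "exp_bounded \<mu>"
  shows "eser (\<lambda>n. c * \<mu> n) u = c * eser \<mu> u"
  unfolding eser_def suminf_mult[OF eser_summable[OF assms], symmetric]
  by (simp only: times_divide_eq_right mult.assoc)

lemma eser_finite:
  "finite A \<Longrightarrow> (\<And>n. n \<notin> A \<Longrightarrow> \<mu> n = 0) \<Longrightarrow> eser \<mu> u = (\<Sum>n\<in>A. \<mu> n * (- u) ^ n / fact n)"
  unfolding eser_def by (rule suminf_finite) auto

lemma eser_split:
  assumes "exp_bounded \<mu>" "finite A"
  shows "eser \<mu> u = (\<Sum>n\<in>A. \<mu> n * (- u) ^ n / fact n) + eser (\<lambda>n. if n \<in> A then 0 else \<mu> n) u"
proof -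
  have "eser \<mu> u = eser (\<lambda>n. (if n \<notin> A then 0 else \<mu> n) + (if n \<in> A then 0 else \<mu> n)) u"
    by (rule arg_cong[of _ _ "\<lambda>\<mu>. eser \<mu> u"]) auto
  also have "\<dots> = eser (\<lambda>n. if n \<notin> A then 0 else \<mu> n) u + eser (\<lambda>n. if n \<in> A then 0 else \<mu> n) u"
    by (intro eser_add exp_bounded_if assms)
  also have "eser (\<lambda>n. if n \<notin> A then 0 else \<mu> n) u = (\<Sum>n\<in>A. \<mu> n * (- u) ^ n / fact n)"
    using assms by (subst eser_finite[of A]) auto
  finally show ?thesis .
qed

lemma eser_1: "eser (\<lambda>_. 1) u = exp (- u)"
  by (simp add: eser_def exp_def scaleR_conv_of_real divide_inverse mult.commute)

lemma eser_of_nat_mult: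
  assumes "exp_bounded \<mu>"
  shows "eser (\<lambda>n. of_nat n * \<mu> n) u = - u * eser (\<lambda>n. \<mu> (Suc n)) u"
proof -
  have "exp_bounded (\<lambda>n. (0 + 1 * of_nat n) * \<mu> n)"
    by (intro exp_bounded_linear assms)
  hence "summable (\<lambda>n. of_nat n * \<mu> n * (- u) ^ n / fact n)"
    using eser_summable by simp
  hence "eser (\<lambda>n. of_nat n * \<mu> n) u
      = (\<Sum>n. of_nat (Suc n) * \<mu> (Suc n) * (- u) ^ Suc n / fact (Suc n))"
    unfolding eser_def by (subst suminf_split_head) (auto simp del: of_nat_Suc)
  also have "(\<lambda>n. of_nat (Suc n) * \<mu> (Suc n) * (- u) ^ Suc n / fact (Suc n))
      = (\<lambda>n. - u * (\<mu> (Suc n) * (- u) ^ n / fact n))"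
    by (rule ext) (simp add: divide_simps del: of_nat_Suc)
  also have "(\<Sum>n. - u * (\<mu> (Suc n) * (- u) ^ n / fact n)) = - u * eser (\<lambda>n. \<mu> (Suc n)) u"
    unfolding eser_def
    by (intro suminf_mult eser_summable exp_bounded_Suc assms)
  finally show ?thesis .
qed

lemma eser_deriv:
  assumes "exp_bounded \<mu>"
  shows "(eser \<mu> has_field_derivative - eser (\<lambda>n. \<mu> (Suc n)) u) (at u)"
proof -
  define c where "c n = \<mu> n * (-1) ^ n / fact n" for n
  have c: "\<mu> n * (- u) ^ n / fact n = c n * u ^ n" for n u
    by (simp add: c_def power_minus[of u])
  have s: "summable (\<lambda>n. c n * u ^ n)" for u
    using eser_summable[OF assms, of u] by (simp add: c)
  have "diffs c n * u ^ n = - (\<mu> (Suc n) * (- u) ^ n / fact n)" for n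
    unfolding diffs_def c_def by (simp add: power_minus[of u] divide_simps del: of_nat_Suc)
  hence "(\<Sum>n. diffs c n * u ^ n) = - eser (\<lambda>n. \<mu> (Suc n)) u"
    unfolding eser_def using suminf_minus[OF eser_summable[OF exp_bounded_Suc[OF assms], of u]] by simp
  moreover have "eser \<mu> = (\<lambda>u. \<Sum>n. c n * u ^ n)"
    by (simp add: eser_def[abs_def] c)
  ultimately show ?thesis
    using termdiffs_strong_converges_everywhere[of c u] s by simp
qed

lemma eser_linear:
  assumes "exp_bounded \<mu>"
  shows "eser (\<lambda>n. (c + d * of_nat n) * \<mu> n) u = c * eser \<mu> u - d * u * eser (\<lambda>n. \<mu> (Suc n)) u"
proof -
  have b: "exp_bounded (\<lambda>n. of_nat n * \<mu> n)"
    using exp_bounded_linear[OF assms, of 0 1] by simp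
  have "exp_bounded (\<lambda>n. c * \<mu> n)" "exp_bounded (\<lambda>n. d * (of_nat n * \<mu> n))"
    using exp_bounded_linear[OF assms, of c 0] exp_bounded_linear[OF assms, of 0 d] by (simp_all add: mult.assoc)
  hence "eser (\<lambda>n. c * \<mu> n + d * (of_nat n * \<mu> n)) u = c * eser \<mu> u + d * eser (\<lambda>n. of_nat n * \<mu> n) u"
    by (simp add: eser_add eser_cmult b assms)
  thus ?thesis
    by (simp add: eser_of_nat_mult[OF assms] algebra_simps)
qed

text \<open>Termwise this is the derivative of z^(c + d*n). The chain and product rules suffice,
  since \<open>eser_linear\<close> expresses the new series through \<open>eser \<mu>\<close> and
  its derivative.\<close>

lemma powr_mult_eser_deriv:
  assumes \<mu>: "exp_bounded \<mu>" and z: "Re z > 0"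
  shows "((\<lambda>z. z powr c * eser \<mu> (x * z powr d)) has_field_derivative
           z powr (c - 1) * eser (\<lambda>n. (c + d * of_nat n) * \<mu> n) (x * z powr d)) (at z)"
proof -
  have nz: "z \<notin> \<real>\<^sub>\<le>\<^sub>0" "z \<noteq> 0"
    using z by (auto simp: complex_nonpos_Reals_iff)
  have 1: "((\<lambda>z. x * z powr d) has_field_derivative x * (d * z powr (d - 1))) (at z)"
    using nz by (auto intro!: derivative_eq_intros)
  have 2: "((\<lambda>z. eser \<mu> (x * z powr d)) has_field_derivative
       - eser (\<lambda>n. \<mu> (Suc n)) (x * z powr d) * (x * (d * z powr (d - 1)))) (at z)"
    using DERIV_chain2[OF eser_deriv[OF \<mu>] 1] .
  have 3: "((\<lambda>z. z powr c) has_field_derivative c * z powr (c - 1)) (at z)"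
    using nz by (auto intro!: derivative_eq_intros)
  have eq: "c * z powr (c - 1) * eser \<mu> (x * z powr d) +
      - eser (\<lambda>n. \<mu> (Suc n)) (x * z powr d) * (x * (d * z powr (d - 1))) * z powr c =
      z powr (c - 1) * eser (\<lambda>n. (c + d * of_nat n) * \<mu> n) (x * z powr d)"
    unfolding eser_linear[OF \<mu>] using nz by (simp add: powr_diff field_simps)
  show ?thesis
    using DERIV_mult[OF 3 2] unfolding eq .
qed

text \<open>The shifted series is minus the derivative of \<open>eser \<mu>\<close>, that is (p -
  p') exp(-u). Hence \<open>eser_linear\<close> gives the new polynomial c p + d u (p' - p).\<close>

lemma eser_poly_exp:
  assumes \<mu>: "exp_bounded \<mu>" and p: "\<And>u. eser \<mu> u = poly p u * exp (- u)"
  shows "\<exists>q. \<forall>u. eser (\<lambda>n. (c + d * of_nat n) * \<mu> n) u = poly q u * exp (- u)"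
proof -
  have "- eser (\<lambda>n. \<mu> (Suc n)) u = poly (pderiv p - p) u * exp (- u)" for u
  proof (rule DERIV_unique[OF eser_deriv[OF \<mu>]])
    have "((\<lambda>u. poly p u * exp (- u)) has_field_derivative poly (pderiv p - p) u * exp (- u)) (at u)"
      by (auto intro!: derivative_eq_intros simp: algebra_simps)
    moreover have "eser \<mu> = (\<lambda>u. poly p u * exp (- u))"
      by (rule ext) (rule p)
    ultimately show "(eser \<mu> has_field_derivative poly (pderiv p - p) u * exp (- u)) (at u)"
      by (simp only:)
  qed
  hence "eser (\<lambda>n. (c + d * of_nat n) * \<mu> n) u = poly (smult c p + pCons 0 (smult d (pderiv p - p))) u * exp (- u)" for u
    unfolding eser_linear[OF \<mu>] by (simp add: p algebra_simps)
  thus ?thesis by blast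
qed

text \<open>In the unit disc every surviving power is at most |u|^(N+1), and the remaining factors
  have a finite sum.\<close>

lemma eser_bound_unit:
  assumes \<mu>: "exp_bounded \<mu>" and 0: "\<And>n. n \<le> N \<Longrightarrow> \<mu> n = 0"
  shows "\<exists>C. \<forall>u. norm u \<le> 1 \<longrightarrow> norm (eser \<mu> u) \<le> C * norm u ^ Suc N"
proof (intro exI allI impI)
  fix u :: complex assume u: "norm u \<le> 1"
  have s: "summable (\<lambda>n. norm (\<mu> n) / fact n)"
    using eser_summable_norm[OF \<mu>, of 1] by (simp add: norm_mult norm_divide norm_power)
  have "norm (eser \<mu> u) \<le> (\<Sum>n. norm u ^ Suc N * (norm (\<mu> n) / fact n))"
    unfolding eser_def
  proof (rule norm_suminf_le)
    show "summable (\<lambda>n. norm u ^ Suc N * (norm (\<mu> n) / fact n))"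
      by (intro summable_mult s)
    fix n
    show "norm (\<mu> n * (- u) ^ n / fact n) \<le> norm u ^ Suc N * (norm (\<mu> n) / fact n)"
    proof (cases "n \<le> N")
      case False
      hence "norm u ^ n \<le> norm u ^ Suc N"
        using u by (intro power_decreasing) auto
      hence "norm u ^ n * (norm (\<mu> n) / fact n) \<le> norm u ^ Suc N * (norm (\<mu> n) / fact n)"
        by (intro mult_right_mono) auto
      thus ?thesis by (simp add: norm_mult norm_divide norm_power mult.commute)
    qed (use 0 in auto)
  qed
  also have "\<dots> = (\<Sum>n. norm (\<mu> n) / fact n) * norm u ^ Suc N"
    using s by (subst suminf_mult) auto
  finally show "norm (eser \<mu> u) \<le> (\<Sum>n. norm (\<mu> n) / fact n) * norm u ^ Suc N" .
qed

lemma power_div_fact_le_exp: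
  assumes "(u::real) \<ge> 0"
  shows "u ^ i * exp (- u) \<le> fact i"
proof -
  have "(\<Sum>n\<in>{i}. inverse (fact n) * u ^ n) \<le> (\<Sum>n. inverse (fact n) * u ^ n)"
    using assms by (intro sum_le_suminf summable_exp) auto
  also have "\<dots> = exp u" by (simp add: exp_def scaleR_conv_of_real)
  finally show ?thesis by (simp add: exp_minus field_simps)
qed

lemma poly_exp_bounded: "\<exists>B. \<forall>u\<ge>0. norm (poly p (of_real u) * exp (- of_real u) :: complex) \<le> B"
proof (intro exI allI impI)
  fix u :: real assume u: "u \<ge> 0"
  have "norm (poly p (of_real u) * exp (- of_real u) :: complex)
      = norm (\<Sum>i\<le>degree p. coeff p i * of_real (u ^ i * exp (- u)))"
    by (simp add: poly_altdef sum_distrib_left exp_of_real [symmetric] mult_ac)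
  also have "\<dots> \<le> (\<Sum>i\<le>degree p. norm (coeff p i) * fact i)"
    using u power_div_fact_le_exp[OF u]
    by (intro sum_norm_le) (auto simp: norm_mult norm_power intro!: mult_left_mono)
  finally show "norm (poly p (of_real u) * exp (- of_real u) :: complex) \<le> (\<Sum>i\<le>degree p. norm (coeff p i) * fact i)" .
qed

text \<open>For u <= 1 the tail starts at u^(N+1). For u >= 1 it is the whole series, bounded by
  exponential decay, minus a polynomial of degree at most N. So the power u^(N+1) dominates on the
  entire half-line.\<close>

lemma eser_tail_bound:
  assumes \<mu>: "exp_bounded \<mu>" and p: "\<And>u. eser \<mu> u = poly p u * exp (- u)"
  shows "\<exists>C. \<forall>u\<ge>0. norm (eser (\<lambda>n. if n \<in> {..N} then 0 else \<mu> n) (of_real u)) \<le> C * u ^ Suc N"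
proof -
  let ?\<nu> = "\<lambda>n. if n \<in> {..N} then 0 else \<mu> n"
  obtain C1 where C1: "\<And>u. norm u \<le> 1 \<Longrightarrow> norm (eser ?\<nu> u) \<le> C1 * norm u ^ Suc N"
    using eser_bound_unit[OF exp_bounded_if[OF \<mu>], of N "\<lambda>n. n \<in> {..N}"] by auto
  obtain B where B: "\<And>u::real. u \<ge> 0 \<Longrightarrow> norm (poly p (of_real u) * exp (- of_real u)) \<le> B"
    using poly_exp_bounded[of p] by auto
  define C2 where "C2 = B + (\<Sum>n\<le>N. norm (\<mu> n))"
  have "norm (eser ?\<nu> (of_real u)) \<le> C2 * u ^ Suc N" if u: "u \<ge> 1" for u
  proof -
    have "B \<ge> 0" by (rule order.trans[OF norm_ge_zero B[of 0]]) simp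
    have "eser ?\<nu> (of_real u) = poly p (of_real u) * exp (- of_real u) - (\<Sum>n\<le>N. \<mu> n * (- of_real u) ^ n / fact n)"
      using eser_split[OF \<mu>, of "{..N}" "of_real u"] p by (simp add: algebra_simps)
    hence "norm (eser ?\<nu> (of_real u)) \<le> norm (poly p (of_real u) * exp (- of_real u))
        + norm (\<Sum>n\<le>N. \<mu> n * (- of_real u) ^ n / fact n)"
      by (simp only: norm_triangle_ineq4)
    also have "norm (\<Sum>n\<le>N. \<mu> n * (- of_real u) ^ n / fact n) \<le> (\<Sum>n\<le>N. norm (\<mu> n) * u ^ Suc N)"
    proof (intro sum_norm_le)
      fix n assume n: "n \<in> {..N}"
      have "norm (\<mu> n) * (u ^ n / fact n) \<le> norm (\<mu> n) * (u ^ n / 1)"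
        using u by (intro mult_left_mono divide_left_mono) auto
      also have "\<dots> \<le> norm (\<mu> n) * u ^ Suc N"
        using u n power_increasing[of n "Suc N" u] by (intro mult_left_mono) auto
      finally show "norm (\<mu> n * (- of_real u) ^ n / fact n) \<le> norm (\<mu> n) * u ^ Suc N"
        using u by (simp add: norm_mult norm_divide norm_power)
    qed
    also have "norm (poly p (of_real u) * exp (- of_real u)) \<le> B * 1"
      using B u by auto
    also have "B * 1 \<le> B * u ^ Suc N"
      using u \<open>B \<ge> 0\<close> by (intro mult_left_mono one_le_power) auto
    finally show ?thesis
      by (simp add: C2_def distrib_right sum_distrib_right)
  qed
  note C2 = this
  have "norm (eser ?\<nu> (of_real u)) \<le> max C1 C2 * u ^ Suc N" if "u \<ge> 0" for u
  proof -
    have "norm (eser ?\<nu> (of_real u)) \<le> C1 * u ^ Suc N \<or> norm (eser ?\<nu> (of_real u)) \<le> C2 * u ^ Suc N"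
    proof (cases "u \<le> 1")
      case True
      have "norm (complex_of_real u) = u" using that by simp
      thus ?thesis using C1[of "of_real u"] True by presburger
    next
      case False
      thus ?thesis using C2[of u] by (meson linear)
    qed
    moreover have "C1 * u ^ Suc N \<le> max C1 C2 * u ^ Suc N" "C2 * u ^ Suc N \<le> max C1 C2 * u ^ Suc N"
      using that by (intro mult_right_mono; simp)+
    ultimately show ?thesis by linarith
  qed
  thus ?thesis by blast
qed

lemma powr_exp_powr_tendsto_0:
  assumes "a > 0" "x > 0"
  shows "((\<lambda>t::real. t powr \<beta> * exp (- (x * t powr a))) \<longlongrightarrow> 0) at_top"
  using assms by real_asymp

lemma poly_exp_tendsto_0:
  assumes a: "a > 0" and x: "x > 0"
  shows "((\<lambda>t. of_real t powr c * (poly p (of_real (x * t powr a)) * exp (- of_real (x * t powr a)))) \<longlongrightarrow> (0::complex)) at_top"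
proof (rule tendsto_norm_zero_cancel)
  have ev: "eventually (\<lambda>t. (\<Sum>i\<le>degree p. norm (coeff p i) * x ^ i * (t powr (Re c + a * real i) * exp (- (x * t powr a)))) \<ge>
     norm (of_real t powr c * (poly p (of_real (x * t powr a)) * exp (- of_real (x * t powr a))))) at_top"
    using eventually_gt_at_top[of 0]
  proof eventually_elim
    case (elim t)
    have "of_real t powr c * (poly p (of_real (x * t powr a)) * exp (- of_real (x * t powr a)))
       = (\<Sum>i\<le>degree p. of_real t powr c * (coeff p i * of_real ((x * t powr a) ^ i) * of_real (exp (- (x * t powr a)))))"
      by (simp add: poly_altdef sum_distrib_right sum_distrib_left exp_of_real [symmetric])
    also have "norm \<dots> \<le> (\<Sum>i\<le>degree p. norm (coeff p i) * x ^ i * (t powr (Re c + a * real i) * exp (- (x * t powr a))))"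
    proof (intro sum_norm_le)
      fix i
      have "(t powr a) ^ i = t powr (a * real i)"
        using elim by (simp add: powr_realpow [symmetric] powr_powr)
      thus "norm (of_real t powr c * (coeff p i * of_real ((x * t powr a) ^ i) * of_real (exp (- (x * t powr a)))))
          \<le> norm (coeff p i) * x ^ i * (t powr (Re c + a * real i) * exp (- (x * t powr a)))"
        using elim x
        by (simp add: norm_mult norm_power norm_of_real_powr powr_add power_mult_distrib)
    qed
    finally show ?case .
  qed
  have lim: "((\<lambda>t. \<Sum>i\<le>degree p. norm (coeff p i) * x ^ i * (t powr (Re c + a * real i) * exp (- (x * t powr a)))) \<longlongrightarrow>
       (\<Sum>i\<le>degree p. norm (coeff p i) * x ^ i * 0)) at_top"
    by (intro tendsto_sum tendsto_mult_left powr_exp_powr_tendsto_0 a x)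
  show "((\<lambda>t. norm (of_real t powr c * (poly p (of_real (x * t powr a)) * exp (- of_real (x * t powr a))))) \<longlongrightarrow> 0) at_top"
    by (rule tendsto_sandwich[OF _ ev tendsto_const]) (use lim in auto)
qed

subsection \<open>The lower incomplete gamma function\<close>

text \<open>Coefficients of the power series part of the \<open>j\<close>-th derivative, indexed as in \<^const>\<open>pw\<close>.\<close>
definition dcoeff :: "complex \<Rightarrow> complex \<Rightarrow> nat \<Rightarrow> nat \<Rightarrow> complex" where
  "dcoeff w d j n = (if j = 0 then 1 / (w + d * of_nat n)
     else (\<Prod>i\<in>{1..<j}. w + d * of_nat n - of_nat i))"

lemma dcoeff_1 [simp]: "dcoeff w d (Suc 0) n = 1"
  by (simp add: dcoeff_def)

text \<open>In the resonant case w + d*n = 0 division by zero makes the coefficient at j = 0 equal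
  to 0, and the recursion breaks there. The missing term is a logarithm, carried separately in
  \<open>pw\<close> and \<open>lgam\<close>.\<close>

lemma dcoeff_Suc:
  assumes "j > 0 \<or> w + d * of_nat n \<noteq> 0"
  shows "dcoeff w d (Suc j) n = (w - of_nat j + d * of_nat n) * dcoeff w d j n"
proof (cases "j = 0")
  case True
  thus ?thesis using assms by (simp add: dcoeff_def)
next
  case False
  hence "{1..<Suc j} = insert j {1..<j}" by auto
  thus ?thesis using False by (simp add: dcoeff_def algebra_simps)
qed

lemma exp_bounded_dcoeff:
  assumes "d \<noteq> 0"
  shows "exp_bounded (dcoeff w d j)"
proof (induction j)
  case 0
  have "filterlim (\<lambda>n. d * of_nat n :: complex) at_infinity sequentially"
    using assms by (intro tendsto_mult_filterlim_at_infinity[OF tendsto_const] tendsto_of_nat) auto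
  hence "filterlim (\<lambda>n. w + d * of_nat n) at_infinity sequentially"
    by (rule tendsto_add_filterlim_at_infinity[OF tendsto_const])
  hence "(\<lambda>n. 1 / (w + d * of_nat n)) \<longlonglongrightarrow> 0"
    by (rule tendsto_divide_0[OF tendsto_const])
  hence "Bseq (\<lambda>n. 1 / (w + d * of_nat n))"
    by (intro convergent_imp_Bseq convergentI)
  thus ?case
    by (intro exp_bounded_Bseq) (simp add: dcoeff_def)
next
  case (Suc j)
  show ?case
  proof (cases "j = 0")
    case True
    thus ?thesis using exp_bounded_const[of 1] by (simp add: dcoeff_def)
  next
    case False
    hence "dcoeff w d (Suc j) = (\<lambda>n. (w - of_nat j + d * of_nat n) * dcoeff w d j n)"
      by (intro ext dcoeff_Suc) auto
    thus ?thesis using exp_bounded_linear[OF Suc.IH] by simp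
  qed
qed

text \<open>The induction starts at j = 1, where all coefficients are 1 and the series is exp(-u).
  The case j = 0 is an incomplete gamma function and is excluded.\<close>

lemma eser_dcoeff_poly_exp:
  assumes d: "d \<noteq> 0" and j: "j > 0"
  shows "\<exists>p. \<forall>u. eser (dcoeff w d j) u = poly p u * exp (- u)"
  using j
proof (induction j rule: nat_induct_non_zero)
  case 1
  have "dcoeff w d 1 = (\<lambda>_. 1)" by (simp add: fun_eq_iff)
  hence "\<forall>u. eser (dcoeff w d 1) u = poly 1 u * exp (- u)"
    by (simp add: eser_1)
  thus ?case by blast
next
  case (Suc j)
  then obtain p where p: "\<And>u. eser (dcoeff w d j) u = poly p u * exp (- u)" by blast
  have "dcoeff w d (Suc j) = (\<lambda>n. (w - of_nat j + d * of_nat n) * dcoeff w d j n)"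
    using Suc.hyps by (intro ext dcoeff_Suc) auto
  thus ?case
    using eser_poly_exp[OF exp_bounded_dcoeff[OF d] p] by simp
qed

text \<open>The residue of \<^const>\<open>Gamma\<close> at \<open>s\<close>.\<close>
definition gamma_res :: "complex \<Rightarrow> complex" where
  "gamma_res s = (if s \<in> \<int>\<^sub>\<le>\<^sub>0 then (-1) ^ nat \<lfloor>- Re s\<rfloor> / fact (nat \<lfloor>- Re s\<rfloor>) else 0)"

lemma gamma_res_of_nat: "gamma_res (- of_nat m) = (-1) ^ m / fact m"
  by (simp add: gamma_res_def)

lemma gamma_res_0: "s \<notin> \<int>\<^sub>\<le>\<^sub>0 \<Longrightarrow> gamma_res s = 0"
  by (simp add: gamma_res_def)

text \<open>A primitive of \<open>z powr (s - 1) * exp (- z)\<close>: the lower incomplete gamma function,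
  continued to all \<open>s\<close>, with a logarithm at the poles.\<close>
definition lgam :: "complex \<Rightarrow> complex \<Rightarrow> complex" where
  "lgam s z = z powr s * eser (dcoeff s 1 0) z + gamma_res s * Ln z"

text \<open>The index set contains at most the single n = -s, and u^s (-u)^n / n! is then free of u.
  Off the poles both sides are 0, so later formulas need no case distinction.\<close>

lemma gamma_res_sum:
  assumes "u > 0"
  shows "complex_of_real u powr s * (\<Sum>n\<in>{n. s + of_nat n = 0}. (- of_real u) ^ n / fact n) = gamma_res s"
proof (cases "s \<in> \<int>\<^sub>\<le>\<^sub>0")
  case True
  then obtain m where m: "s = - of_nat m" by (elim nonpos_Ints_cases')
  have "{n. s + of_nat n = 0} = {m}" using m by auto
  moreover have "complex_of_real u powr s = inverse (of_real u ^ m)"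
    using assms by (simp add: m powr_minus powr_nat')
  ultimately show ?thesis
    using assms by (simp add: m gamma_res_of_nat power_minus[of "of_real u"])
next
  case False
  hence "{n. s + of_nat n = 0} = {}"
    by (auto simp: add_eq_0_iff2)
  thus ?thesis using False by (simp add: gamma_res_0)
qed

lemma finite_zeros: "finite {n. s + of_nat n = (0::complex)}"
proof -
  have "{n. s + of_nat n = 0} \<subseteq> {nat \<lfloor>- Re s\<rfloor>}"
    by (auto simp: add_eq_0_iff2)
  thus ?thesis by (rule finite_subset) auto
qed

text \<open>Multiplying 1 / (s + n) by s + n restores 1 except at a resonant index, where 0
  remains.\<close>

lemma eser_dcoeff_linear:
  "eser (\<lambda>n. (s + 1 * of_nat n) * dcoeff s 1 0 n) u
     = exp (- u) - (\<Sum>n\<in>{n. s + of_nat n = 0}. (- u) ^ n / fact n)"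
proof -
  let ?A = "{n. s + of_nat n = 0}"
  have "(\<lambda>n. (s + 1 * of_nat n) * dcoeff s 1 0 n) = (\<lambda>n. if n \<in> ?A then 0 else 1)"
    by (auto simp: dcoeff_def fun_eq_iff)
  thus ?thesis
    using eser_split[OF exp_bounded_const[of 1] finite_zeros[of s], of u]
    by (simp add: eser_1 algebra_simps)
qed

text \<open>Integration by parts for the incomplete gamma function. At a pole the exponential series
  lacks its resonant term, which accounts for \<open>gamma_res s\<close>.\<close>

lemma lgam_rec:
  assumes "u > 0"
  shows "s * lgam s (of_real u) = lgam (s + 1) (of_real u) + of_real u powr s * exp (- of_real u) - gamma_res s"
proof -
  let ?u = "complex_of_real u"
  have "s * eser (dcoeff s 1 0) ?u - 1 * ?u * eser (\<lambda>n. dcoeff s 1 0 (Suc n)) ?u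
      = exp (- ?u) - (\<Sum>n\<in>{n. s + of_nat n = 0}. (- ?u) ^ n / fact n)"
    unfolding eser_dcoeff_linear[symmetric] by (subst eser_linear[OF exp_bounded_dcoeff]) auto
  moreover have "(\<lambda>n. dcoeff s 1 0 (Suc n)) = dcoeff (s + 1) 1 0"
    by (simp add: dcoeff_def fun_eq_iff algebra_simps)
  ultimately have "s * eser (dcoeff s 1 0) ?u = exp (- ?u) + ?u * eser (dcoeff (s + 1) 1 0) ?u
       - (\<Sum>n\<in>{n. s + of_nat n = 0}. (- ?u) ^ n / fact n)"
    by (simp add: algebra_simps)
  note eq = this
  have "?u powr s * (s * eser (dcoeff s 1 0) ?u) = ?u powr s * exp (- ?u) + ?u powr (s + 1) * eser (dcoeff (s + 1) 1 0) ?u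
       - gamma_res s"
    unfolding eq gamma_res_sum[OF assms, of s, symmetric]
    using assms by (simp add: powr_add algebra_simps)
  \<comment> \<open>The residue form of Gamma(s + 1) = s Gamma(s); it matches the logarithmic
    parts.\<close>
  moreover have "s * gamma_res s = gamma_res (s + 1)"
  proof (cases "s \<in> \<int>\<^sub>\<le>\<^sub>0")
    case True
    then obtain m where m: "s = - of_nat m" by (elim nonpos_Ints_cases')
    show ?thesis
    proof (cases m)
      case 0
      thus ?thesis by (simp add: m gamma_res_0)
    next
      case (Suc k)
      have "s + 1 = - of_nat k" using m Suc by simp
      thus ?thesis
        by (simp only: gamma_res_of_nat m Suc) (simp add: divide_simps del: of_nat_Suc)
    qed
  next
    case False
    moreover from False have "s + 1 \<notin> \<int>\<^sub>\<le>\<^sub>0"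
      using plus_one_in_nonpos_Ints_imp by blast
    ultimately show ?thesis by (simp add: gamma_res_0)
  qed
  moreover have "s * lgam s ?u = ?u powr s * (s * eser (dcoeff s 1 0) ?u) + s * gamma_res s * Ln ?u"
    by (simp add: lgam_def algebra_simps)
  ultimately show ?thesis
    by (simp add: lgam_def)
qed

lemma lgam_deriv:
  assumes u: "u > 0"
  shows "((\<lambda>u. lgam s (of_real u)) has_vector_derivative of_real u powr (s - 1) * exp (- of_real u)) (at u)"
proof -
  have nz: "complex_of_real u \<notin> \<real>\<^sub>\<le>\<^sub>0" "complex_of_real u \<noteq> 0"
    using u by (auto simp: complex_nonpos_Reals_iff)
  \<comment> \<open>The argument z is written \<open>1 * z powr 1\<close> to fit
    \<open>powr_mult_eser_deriv\<close> with x = d = 1.\<close>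
  have 1: "((\<lambda>z. z powr s * eser (dcoeff s 1 0) (1 * z powr 1)) has_field_derivative
       of_real u powr (s - 1) * eser (\<lambda>n. (s + 1 * of_nat n) * dcoeff s 1 0 n) (1 * of_real u powr 1)) (at (of_real u))"
    using u by (intro powr_mult_eser_deriv exp_bounded_dcoeff) auto
  have "complex_of_real u powr (s - 1) * (\<Sum>n\<in>{n. s + of_nat n = 0}. (- of_real u) ^ n / fact n) = gamma_res s / of_real u"
    using gamma_res_sum[OF u, of s, symmetric] nz by (simp add: powr_diff)
  hence "of_real u powr (s - 1) * eser (\<lambda>n. (s + 1 * of_nat n) * dcoeff s 1 0 n) (1 * of_real u powr 1)
       + gamma_res s / of_real u = of_real u powr (s - 1) * exp (- of_real u)"
    unfolding eser_dcoeff_linear using nz by (simp add: right_diff_distrib powr_def[of _ 1])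
  moreover have 2: "((\<lambda>z. gamma_res s * Ln z) has_field_derivative gamma_res s / of_real u) (at (of_real u))"
    using nz by (auto intro!: derivative_eq_intros simp: field_simps)
  moreover have "lgam s = (\<lambda>z. z powr s * eser (dcoeff s 1 0) (1 * z powr 1) + gamma_res s * Ln z)"
    by (auto simp: lgam_def fun_eq_iff powr_def)
  ultimately have "(lgam s has_field_derivative of_real u powr (s - 1) * exp (- of_real u)) (at (of_real u))"
    using DERIV_add[OF 1 2] by (simp only:)
  thus ?thesis
    by (rule has_vector_derivative_real_field)
qed

text \<open>For Re s > 0 the function is continuous up to 0 and vanishes there, so it is the
  integral from 0 and tends to Euler's integral.\<close>

lemma lgam_tendsto_Gamma_pos:
  assumes s: "Re s > 0"
  shows "((\<lambda>u. lgam s (of_real u)) \<longlongrightarrow> Gamma s) at_top"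
proof -
  let ?f = "\<lambda>t. complex_of_real t powr (s - 1) / of_real (exp t)"
  have s': "s \<notin> \<int>\<^sub>\<le>\<^sub>0" using s by (auto elim!: nonpos_Ints_cases')
  have int: "(?f has_integral lgam s (of_real b)) {0..b}" if b: "b \<ge> 0" for b
  proof -
    have "eser (dcoeff s 1 0) field_differentiable at z" for z
      using eser_deriv[OF exp_bounded_dcoeff[of 1]] unfolding field_differentiable_def by force
    hence "continuous_on UNIV (eser (dcoeff s 1 0))"
      by (simp add: continuous_at_imp_continuous_on field_differentiable_imp_continuous_at)
    hence c: "continuous_on {0..b} (\<lambda>u. eser (dcoeff s 1 0) (of_real u))"
      by (rule continuous_on_compose2) (auto intro!: continuous_intros)
    have "continuous_on {0..b} (\<lambda>u. complex_of_real u powr s * eser (dcoeff s 1 0) (of_real u))"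
      using s by (intro continuous_on_mult c continuous_on_powr_complex continuous_intros) auto
    hence "continuous_on {0..b} (\<lambda>u. lgam s (of_real u))"
      by (simp add: lgam_def gamma_res_0[OF s'])
    moreover have "((\<lambda>u. lgam s (of_real u)) has_vector_derivative ?f u) (at u)" if "u \<in> {0<..<b}" for u
    proof -
      have "?f u = of_real u powr (s - 1) * exp (- of_real u)"
        by (simp add: exp_minus exp_of_real field_simps)
      thus ?thesis using lgam_deriv[of u s] that by simp
    qed
    ultimately have "(?f has_integral lgam s (of_real b) - lgam s (of_real 0)) {0..b}"
      using b by (intro fundamental_theorem_of_calculus_interior)
    thus ?thesis using s by (simp add: lgam_def gamma_res_0[OF s'])
  qed
  have "?f absolutely_integrable_on {0<..}"
    using absolutely_integrable_Gamma_integral'[OF s] .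
  moreover have "negligible ({0..} - {0<..} :: real set)" "negligible ({0<..} - {0..} :: real set)"
    by (auto intro: negligible_subset[of "{0}"])
  ultimately have ai: "?f absolutely_integrable_on {0..}"
    by (subst absolutely_integrable_spike_set_eq[of _ "{0<..}"])
       (auto intro: negligible_subset)
  have "((\<lambda>b. LINT t:{0..b}|lebesgue. ?f t) \<longlongrightarrow> (LINT t:{0..}|lebesgue. ?f t)) at_top"
    by (rule tendsto_set_lebesgue_integral_at_top[OF _ ai]) auto
  also have "(LINT t:{0..}|lebesgue. ?f t) = Gamma s"
    using set_lebesgue_integral_eq_integral(2)[OF ai] integral_unique[OF Gamma_integral_complex[OF s]] by simp
  finally have "((\<lambda>b. LINT t:{0..b}|lebesgue. ?f t) \<longlongrightarrow> Gamma s) at_top" .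
  moreover have "eventually (\<lambda>b. (LINT t:{0..b}|lebesgue. ?f t) = lgam s (of_real b)) at_top"
    using eventually_ge_at_top[of 0]
  proof eventually_elim
    case (elim b)
    have "?f absolutely_integrable_on {0..b}"
      by (rule set_integrable_subset[OF ai]) auto
    thus ?case
      using set_lebesgue_integral_eq_integral(2) integral_unique[OF int[OF elim]] by metis
  qed
  ultimately show ?thesis
    by (rule Lim_transform_eventually)
qed

lemma powr_mult_exp_tendsto_0:
  "((\<lambda>u. complex_of_real u powr s * exp (- of_real u)) \<longlongrightarrow> 0) at_top"
proof (rule tendsto_norm_zero_cancel)
  have "((\<lambda>u::real. u powr Re s * exp (- u)) \<longlongrightarrow> 0) at_top"
    by real_asymp
  moreover have "eventually (\<lambda>u. u powr Re s * exp (- u) = norm (complex_of_real u powr s * exp (- of_real u))) at_top"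
    using eventually_gt_at_top[of 0]
    by eventually_elim (simp add: norm_mult norm_of_real_powr)
  ultimately show "((\<lambda>u. norm (complex_of_real u powr s * exp (- of_real u))) \<longlongrightarrow> 0) at_top"
    by (rule Lim_transform_eventually)
qed

section \<open>Limits of the incomplete gamma function for the remaining s\<close>

lemma lgam_tendsto_step:
  assumes "s \<noteq> 0" and lim: "((\<lambda>u. lgam (s + 1) (of_real u)) \<longlongrightarrow> L) at_top"
  shows "((\<lambda>u. lgam s (of_real u)) \<longlongrightarrow> (L - gamma_res s) / s) at_top"
proof -
  have "((\<lambda>u. (lgam (s + 1) (of_real u) + of_real u powr s * exp (- of_real u) - gamma_res s) / s)
      \<longlongrightarrow> (L + 0 - gamma_res s) / s) at_top"
    by (intro tendsto_intros lim powr_mult_exp_tendsto_0 assms(1))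
  moreover have "eventually (\<lambda>u. (lgam (s + 1) (of_real u) + of_real u powr s * exp (- of_real u) - gamma_res s) / s
      = lgam s (of_real u)) at_top"
    using eventually_gt_at_top[of 0]
    by eventually_elim (use assms(1) in \<open>simp add: lgam_rec [symmetric]\<close>)
  ultimately show ?thesis
    by (simp add: Lim_transform_eventually)
qed

lemma lgam_tendsto_Gamma:
  assumes "s \<notin> \<int>\<^sub>\<le>\<^sub>0"
  shows "((\<lambda>u. lgam s (of_real u)) \<longlongrightarrow> Gamma s) at_top"
proof -
  have "((\<lambda>u. lgam s (of_real u)) \<longlongrightarrow> Gamma s) at_top" if "Re s + real k > 0" "s \<notin> \<int>\<^sub>\<le>\<^sub>0" for k s
    using that
  proof (induction k arbitrary: s)
    case 0
    thus ?case using lgam_tendsto_Gamma_pos[of s] by simp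
  next
    case (Suc k)
    have "s + 1 \<notin> \<int>\<^sub>\<le>\<^sub>0"
      using Suc.prems plus_one_in_nonpos_Ints_imp by blast
    hence "((\<lambda>u. lgam (s + 1) (of_real u)) \<longlongrightarrow> Gamma (s + 1)) at_top"
      using Suc.prems by (intro Suc.IH) auto
    moreover have "s \<noteq> 0" using Suc.prems by auto
    ultimately have "((\<lambda>u. lgam s (of_real u)) \<longlongrightarrow> (Gamma (s + 1) - gamma_res s) / s) at_top"
      by (intro lgam_tendsto_step)
    thus ?case
      using Suc.prems \<open>s \<noteq> 0\<close> by (simp add: gamma_res_0 Gamma_plus1)
  qed
  from this[of s "nat \<lceil>1 - Re s\<rceil>"] show ?thesis
    using assms by (simp add: le_nat_iff) linarith
qed

text \<open>Only existence is needed here. For u >= 1 the derivative exp(-u) / u is at most exp(-u),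
  so increments are dominated by those of -exp(-u).\<close>

lemma lgam_0_convergent: "\<exists>L. ((\<lambda>u. lgam 0 (of_real u)) \<longlongrightarrow> L) at_top"
proof -
  let ?f = "\<lambda>u. lgam 0 (complex_of_real u)"
  have bd: "norm (?f v - ?f u) \<le> exp (- u)" if "1 \<le> u" "u \<le> v" for u v
  proof (cases "u = v")
    case False
    have der: "((\<lambda>u. lgam 0 (complex_of_real u)) has_vector_derivative of_real x powr (0 - 1) * exp (- of_real x)) (at x)"
      if "x \<ge> 1" for x using lgam_deriv[of x 0] that by simp
    have "norm (?f v - ?f u) \<le> - exp (- v) - - exp (- u)"
    proof (rule differentiable_bound_general[where f = ?f and \<phi> = "\<lambda>u. - exp (- u)"
             and f' = "\<lambda>x. of_real x powr (0 - 1) * exp (- of_real x)" and \<phi>' = "\<lambda>u. exp (- u)"])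
      show "continuous_on {u..v} ?f"
        using that der by (intro continuous_at_imp_continuous_on ballI)
          (auto intro!: has_vector_derivative_continuous[OF der])
      show "((\<lambda>u. - exp (- u)) has_vector_derivative exp (- x)) (at x)" for x :: real
        by (auto intro!: derivative_eq_intros simp: has_real_derivative_iff_has_vector_derivative [symmetric])
      fix x assume "u < x" "x < v"
      hence x: "x \<ge> 1" using that by simp
      show "(?f has_vector_derivative of_real x powr (0 - 1) * exp (- of_real x)) (at x)"
        by (rule der[OF x])
      have "norm (complex_of_real x powr (0 - 1) * exp (- of_real x)) = x powr (-1) * exp (- x)"
        using x by (simp add: norm_mult norm_of_real_powr)
      also have "\<dots> \<le> 1 * exp (- x)"
        using x by (intro mult_right_mono) (auto simp: powr_minus_divide)
      finally show "norm (complex_of_real x powr (0 - 1) * exp (- of_real x)) \<le> exp (- x)" by simp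
    qed (use that False in \<open>auto intro!: continuous_intros\<close>)
    thus ?thesis by (smt (verit) exp_gt_zero)
  qed auto
  define X where "X n = ?f (real (Suc n))" for n
  have lim0: "((\<lambda>u::real. exp (- u)) \<longlongrightarrow> 0) at_top" by real_asymp
  have "Cauchy X"
  proof (rule metric_CauchyI)
    fix e :: real assume e: "e > 0"
    have "eventually (\<lambda>u::real. exp (- u) < e) at_top"
      using order_tendstoD(2)[OF lim0 e] .
    then obtain B where B: "\<And>u. u \<ge> B \<Longrightarrow> exp (- u) < e"
      by (auto simp: eventually_at_top_linorder)
    show "\<exists>M. \<forall>m\<ge>M. \<forall>n\<ge>M. dist (X m) (X n) < e"
    proof (intro exI allI impI)
      fix m n assume mn: "m \<ge> nat \<lceil>B\<rceil>" "n \<ge> nat \<lceil>B\<rceil>"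
      have "dist (X m) (X n) \<le> exp (- real (Suc (min m n)))"
        using bd[of "real (Suc m)" "real (Suc n)"] bd[of "real (Suc n)" "real (Suc m)"]
        by (cases "m \<le> n") (auto simp: X_def dist_norm norm_minus_commute min_def)
      also have "\<dots> < e" using mn by (intro B) linarith
      finally show "dist (X m) (X n) < e" .
    qed
  qed
  then obtain L where L: "X \<longlonglongrightarrow> L"
    by (auto simp: Cauchy_convergent_iff convergent_def)
  have "norm (L - ?f u) \<le> exp (- u)" if u: "u \<ge> 1" for u
  proof (rule tendsto_upperbound[of "\<lambda>n. norm (X n - ?f u)" _ sequentially])
    show "(\<lambda>n. norm (X n - ?f u)) \<longlonglongrightarrow> norm (L - ?f u)"
      by (intro tendsto_intros L)
    show "eventually (\<lambda>n. norm (X n - ?f u) \<le> exp (- u)) sequentially"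
      using eventually_ge_at_top[of "nat \<lceil>u\<rceil>"]
    proof eventually_elim
      case (elim n)
      hence "u \<le> real (Suc n)" by linarith
      thus ?case unfolding X_def using bd[OF u] by blast
    qed
  qed auto
  note le = this
  have "eventually (\<lambda>u. norm (?f u - L) \<le> exp (- u)) at_top"
    using eventually_ge_at_top[of 1]
    by eventually_elim (subst norm_minus_commute, rule le)
  hence "((\<lambda>u. ?f u - L) \<longlongrightarrow> 0) at_top"
    by (rule Lim_null_comparison) (rule lim0)
  thus ?thesis by (intro exI) (rule LIM_zero_cancel)
qed

text \<open>The limit is the finite part of Gamma at -m: the term \<open>gamma_res\<close> in the
  recursion supplies the summand 1 / (m + 1) of the digamma recursion. The base case is a premise
  because it is obtained from the expansion itself.\<close>

lemma lgam_tendsto_Digamma: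
  assumes "((\<lambda>u. lgam 0 (of_real u)) \<longlongrightarrow> - euler_mascheroni) at_top"
  shows "((\<lambda>u. lgam (- of_nat m) (of_real u)) \<longlongrightarrow> (-1) ^ m / fact m * Digamma (of_nat m + 1)) at_top"
proof (induction m)
  case 0
  thus ?case using assms by simp
next
  case (Suc m)
  let ?s = "- of_nat (Suc m) :: complex"
  have s: "?s + 1 = - of_nat m" by simp
  have "((\<lambda>u. lgam ?s (of_real u)) \<longlongrightarrow> ((-1) ^ m / fact m * Digamma (of_nat m + 1) - gamma_res ?s) / ?s) at_top"
    by (rule lgam_tendsto_step) (use Suc s in \<open>simp_all del: of_nat_Suc\<close>)
  also have "((-1) ^ m / fact m * Digamma (of_nat m + 1) - gamma_res ?s) / ?s
      = (-1) ^ Suc m / fact (Suc m) * (Digamma (of_nat m + 1) + 1 / of_nat (Suc m))"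
    unfolding gamma_res_of_nat by (simp add: divide_simps del: of_nat_Suc) (simp add: algebra_simps)
  also have "Digamma (of_nat m + 1) + 1 / of_nat (Suc m) = Digamma (of_nat (Suc m) + 1 :: complex)"
    using Digamma_plus1[of "of_nat (Suc m) :: complex"] by (simp add: add_ac del: of_nat_Suc) (simp add: add_ac)
  finally show ?case .
qed

subsection \<open>The asymptotic expansion\<close>

lemma complex_powr_power: "z \<noteq> 0 \<Longrightarrow> (z powr c) ^ n = z powr (c * of_nat n)" for z c :: complex
  by (simp add: powr_def exp_of_nat_mult [symmetric] mult_ac)

definition tail :: "complex \<Rightarrow> real \<Rightarrow> nat \<Rightarrow> real \<Rightarrow> nat \<Rightarrow> complex \<Rightarrow> complex" where
  "tail w a N x j z = z powr (w - of_nat j) *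
     eser (\<lambda>n. if n \<in> {..N} then 0 else dcoeff w (of_real a) j n) (of_real x * z powr of_real a)"

text \<open>No resonant index lies beyond N, so the tail contains no logarithm and differentiates
  termwise even at j = 0.\<close>

lemma em_smooth_tail:
  assumes a: "a > 0" and N: "\<And>n. n > N \<Longrightarrow> w + of_real a * of_nat n \<noteq> 0"
  shows "em_smooth (tail w a N x)"
  unfolding em_smooth_def
proof (intro allI impI)
  fix j z assume z: "Re z > 0"
  have "(\<lambda>n. (w - of_nat j + of_real a * of_nat n) * (if n \<in> {..N} then 0 else dcoeff w (of_real a) j n))
      = (\<lambda>n. if n \<in> {..N} then 0 else dcoeff w (of_real a) (Suc j) n)"
    using N by (auto simp: fun_eq_iff dcoeff_Suc)
  moreover have "exp_bounded (\<lambda>n. if n \<in> {..N} then 0 else dcoeff w (of_real a) j n)"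
    using a by (intro exp_bounded_if exp_bounded_dcoeff) auto
  ultimately show "(tail w a N x j has_field_derivative tail w a N x (Suc j) z) (at z)"
    using powr_mult_eser_deriv[OF _ z, of "\<lambda>n. if n \<in> {..N} then 0 else dcoeff w (of_real a) j n"
        "w - of_nat j" "of_real x" "of_real a"]
    by (simp add: tail_def[abs_def] diff_diff_eq add.commute)
qed

lemma pw_eq_dcoeff:
  assumes t: "t > 0"
  shows "pw (w + of_real a * of_nat n) j (of_real t) =
     of_real t powr (w - of_nat j) * (dcoeff w (of_real a) j n * (of_real t powr of_real a) ^ n)
       + (if j = 0 \<and> w + of_real a * of_nat n = 0 then of_real (ln t) else 0)"
proof -
  have "complex_of_real t powr (w + of_real a * of_nat n - of_nat j)
      = of_real t powr (w - of_nat j) * (of_real t powr of_real a) ^ n"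
    using t by (simp add: complex_powr_power powr_add [symmetric] algebra_simps)
  thus ?thesis
    using t Ln_of_real[of t] by (auto simp: pw_def dcoeff_def)
qed

text \<open>For j > 0 this closed form shows decay at infinity; for j = 0 it is compared with
  \<open>lgam\<close>.\<close>

lemma head_plus_tail:
  assumes a: "a > 0" and t: "t > 0"
  shows "(\<Sum>n\<le>N. (- of_real x) ^ n / fact n * pw (w + of_real a * of_nat n) j (of_real t)) + tail w a N x j (of_real t)
     = of_real t powr (w - of_nat j) * eser (dcoeff w (of_real a) j) (of_real (x * t powr a))
       + (if j = 0 then (\<Sum>n\<in>{n. n \<le> N \<and> w + of_real a * of_nat n = 0}. (- of_real x) ^ n / fact n) * of_real (ln t) else 0)"
proof -
  define u :: complex where "u = of_real (x * t powr a)"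
  have u: "u = of_real x * of_real t powr of_real a"
    using t by (simp add: u_def powr_of_real)
  have "(\<Sum>n\<le>N. (- of_real x) ^ n / fact n * pw (w + of_real a * of_nat n) j (of_real t))
     = of_real t powr (w - of_nat j) * (\<Sum>n\<le>N. dcoeff w (of_real a) j n * (- u) ^ n / fact n)
      + (\<Sum>n\<le>N. (- of_real x) ^ n / fact n * (if j = 0 \<and> w + of_real a * of_nat n = 0 then of_real (ln t) else 0))"
    unfolding pw_eq_dcoeff[OF t] sum_distrib_left sum.distrib [symmetric]
  proof (intro sum.cong refl)
    fix n
    have "(- u) ^ n = (- of_real x) ^ n * (of_real t powr of_real a) ^ n"
      unfolding u by (simp add: power_mult_distrib [symmetric])
    thus "(- of_real x) ^ n / fact n * (of_real t powr (w - of_nat j) * (dcoeff w (of_real a) j n * (of_real t powr of_real a) ^ n)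
         + (if j = 0 \<and> w + of_real a * of_nat n = 0 then of_real (ln t) else 0))
       = of_real t powr (w - of_nat j) * (dcoeff w (of_real a) j n * (- u) ^ n / fact n)
         + (- of_real x) ^ n / fact n * (if j = 0 \<and> w + of_real a * of_nat n = 0 then of_real (ln t) else 0)"
      by (simp add: distrib_left mult_ac)
  qed
  also have "(\<Sum>n\<le>N. (- of_real x) ^ n / fact n * (if j = 0 \<and> w + of_real a * of_nat n = 0 then of_real (ln t) else 0))
      = (if j = 0 then (\<Sum>n\<in>{n. n \<le> N \<and> w + of_real a * of_nat n = 0}. (- of_real x) ^ n / fact n) * of_real (ln t) else 0 :: complex)"
    by (auto simp: sum_distrib_right intro!: sum.mono_neutral_cong_right split: if_splits)
  finally have head: "(\<Sum>n\<le>N. (- of_real x) ^ n / fact n * pw (w + of_real a * of_nat n) j (of_real t)) =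
      of_real t powr (w - of_nat j) * (\<Sum>n\<le>N. dcoeff w (of_real a) j n * (- u) ^ n / fact n)
      + (if j = 0 then (\<Sum>n\<in>{n. n \<le> N \<and> w + of_real a * of_nat n = 0}. (- of_real x) ^ n / fact n) * of_real (ln t) else 0)" .
  have tail: "tail w a N x j (of_real t)
      = of_real t powr (w - of_nat j) * eser (\<lambda>n. if n \<in> {..N} then 0 else dcoeff w (of_real a) j n) u"
    by (simp only: tail_def u)
  have "eser (dcoeff w (of_real a) j) u = (\<Sum>n\<le>N. dcoeff w (of_real a) j n * (- u) ^ n / fact n)
      + eser (\<lambda>n. if n \<in> {..N} then 0 else dcoeff w (of_real a) j n) u"
    using a by (intro eser_split exp_bounded_dcoeff) auto
  thus ?thesis
    unfolding u_def [symmetric] head tail by (simp only: distrib_left add_ac)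
qed

lemma tail_bound:
  assumes a: "a > 0" and K: "K > 0"
  shows "\<exists>C. \<forall>x>0. \<forall>t>0. norm (tail w a N x K (of_real t)) \<le> C * x ^ Suc N * t powr (Re w + a * real (Suc N) - real K)"
proof -
  have d: "complex_of_real a \<noteq> 0" using a by simp
  obtain p where p: "\<And>u. eser (dcoeff w (of_real a) K) u = poly p u * exp (- u)"
    using eser_dcoeff_poly_exp[OF d K] by blast
  obtain C where C: "\<And>u. u \<ge> 0 \<Longrightarrow>
      norm (eser (\<lambda>n. if n \<in> {..N} then 0 else dcoeff w (of_real a) K n) (of_real u)) \<le> C * u ^ Suc N"
    using eser_tail_bound[OF exp_bounded_dcoeff[OF d] p] by blast
  show ?thesis
  proof (intro exI allI impI)
    fix x t :: real assume x: "x > 0" and t: "t > 0"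
    have "complex_of_real x * of_real t powr of_real a = of_real (x * t powr a)"
      using t by (simp add: powr_of_real)
    hence "norm (tail w a N x K (of_real t))
       = t powr (Re w - real K) * norm (eser (\<lambda>n. if n \<in> {..N} then 0 else dcoeff w (of_real a) K n) (of_real (x * t powr a)))"
      using t by (simp only: tail_def norm_mult norm_of_real_powr) simp
    also have "\<dots> \<le> t powr (Re w - real K) * (C * (x * t powr a) ^ Suc N)"
      using x t by (intro mult_left_mono C) auto
    also have "(x * t powr a) ^ Suc N = x ^ Suc N * t powr (a * real (Suc N))"
      using t by (simp only: power_mult_distrib powr_realpow[symmetric] powr_gt_zero powr_powr)
    finally show "norm (tail w a N x K (of_real t)) \<le> C * x ^ Suc N * t powr (Re w + a * real (Suc N) - real K)"
      by (simp only: powr_add powr_diff) (simp add: mult_ac)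
  qed
qed

text \<open>The boundary terms at t = 1 include j = 0, where no polynomial times exp(-u) is
  available. But there u = x <= 1, so the unit disc bound suffices.\<close>

lemma tail_1_bound:
  assumes a: "a > 0"
  shows "\<exists>C. \<forall>x. 0 < x \<longrightarrow> x \<le> 1 \<longrightarrow> norm (tail w a N x j 1) \<le> C * x ^ Suc N"
proof -
  have "exp_bounded (\<lambda>n. if n \<in> {..N} then 0 else dcoeff w (of_real a) j n)"
    using a by (intro exp_bounded_if exp_bounded_dcoeff) auto
  from eser_bound_unit[OF this, of N] obtain C where C: "\<And>u. norm u \<le> 1 \<Longrightarrow>
     norm (eser (\<lambda>n. if n \<in> {..N} then 0 else dcoeff w (of_real a) j n) u) \<le> C * norm u ^ Suc N"
    by auto
  show ?thesis
  proof (intro exI allI impI)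
    fix x :: real assume "0 < x" "x \<le> 1"
    thus "norm (tail w a N x j 1) \<le> C * x ^ Suc N"
      using C[of "of_real x"] by (simp add: tail_def)
  qed
qed

text \<open>At \<open>w = 0\<close> the pole of zeta is replaced by its finite part.\<close>
definition zconst :: "complex \<Rightarrow> complex" where
  "zconst w = (if w = 0 then euler_mascheroni else riemann_zeta (1 - w))"

lemma em_const_pw: "K > 0 \<Longrightarrow> Re w < real K \<Longrightarrow> em_const K (pw w) = zconst w"
  by (simp add: zconst_def euler_mascheroni_eq_em_const riemann_zeta_eq_em_const)

text \<open>The series equals \<open>em_const K F\<close> for the full family F, whose members all
  vanish at infinity. Linearity splits this into c x, the zeta values and the value of the tail,
  which is O(x^(N+1)).\<close>

lemma exp_dirichlet_series_bound:
  assumes a: "a > 0" and N: "\<And>n. n > N \<Longrightarrow> w + of_real a * of_nat n \<noteq> 0"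
    and lim: "\<And>x. x > 0 \<Longrightarrow> ((\<lambda>t. (\<Sum>n\<le>N. (- of_real x) ^ n / fact n * pw (w + of_real a * of_nat n) 0 (of_real t))
         + tail w a N x 0 (of_real t)) \<longlongrightarrow> c x) at_top"
  shows "\<exists>C. \<forall>x. 0 < x \<longrightarrow> x \<le> 1 \<longrightarrow>
     norm (exp_dirichlet_series a (1 - w) x - (c x + (\<Sum>n\<le>N. (- of_real x) ^ n / fact n * zconst (w + of_real a * of_nat n))))
       \<le> C * x ^ Suc N"
proof -
  \<comment> \<open>One K, independent of x, serves the tail and all powers with n <= N.\<close>
  define K where "K = Suc (nat \<lceil>Re w + a * real (Suc N)\<rceil>)"
  have K: "K > 0" "Re w + a * real (Suc N) < real K"
    unfolding K_def by simp linarith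
  have ReK: "Re (w + of_real a * of_nat n) < real K" if "n \<le> N" for n
  proof -
    have "a * real n \<le> a * real (Suc N)" using that a by (intro mult_left_mono) auto
    thus ?thesis using K by simp
  qed
  define \<alpha> where "\<alpha> = Re w + a * real (Suc N) - real (Suc K)"
  have \<alpha>: "\<alpha> < -1" using K by (simp add: \<alpha>_def)
  obtain C1 where C1: "\<And>x t. x > 0 \<Longrightarrow> t > 0 \<Longrightarrow> norm (tail w a N x (Suc K) (of_real t)) \<le> C1 * x ^ Suc N * t powr \<alpha>"
    using tail_bound[OF a, of "Suc K" w N] unfolding \<alpha>_def by auto
  have "\<forall>j. \<exists>D. \<forall>x. 0 < x \<longrightarrow> x \<le> 1 \<longrightarrow> norm (tail w a N x j 1) \<le> D * x ^ Suc N"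
    using tail_1_bound[OF a] by blast
  then obtain D where D: "\<And>j x. 0 < x \<Longrightarrow> x \<le> 1 \<Longrightarrow> norm (tail w a N x j 1) \<le> D j * x ^ Suc N"
    by metis
  define S where "S = (\<Sum>n. real (Suc n) powr \<alpha>)"
  define C where "C = em_bound K * C1 * S + (\<Sum>j<K. norm (em_coeff j) * D j)"
  show ?thesis
  proof (intro exI allI impI)
    fix x :: real assume x: "0 < x" "x \<le> 1"
    define T where "T = tail w a N x"
    define P where "P n j z = (- complex_of_real x) ^ n / fact n * pw (w + of_real a * of_nat n) j z" for n j z
    \<comment> \<open>Normalises the primitive to vanish at infinity; its own regularised value is c
      x.\<close>
    define Q :: "nat \<Rightarrow> complex \<Rightarrow> complex" where "Q j z = (if j = 0 then - c x else 0)" for j z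
    define F where "F j z = ((\<Sum>n\<le>N. P n j z) + T j z) + Q j z" for j z
    have T_bound: "norm (T (Suc K) (of_real t)) \<le> (C1 * x ^ Suc N) * t powr \<alpha>" if "t \<ge> 1" for t
      unfolding T_def using that x by (intro C1) auto
    have smT: "em_smooth T"
      unfolding T_def by (intro em_smooth_tail a N)
    note sT = em_rest_summable[OF smT K(1) \<alpha> T_bound]
    have sP: "summable (\<lambda>m. em_rest K (P n) (Suc m))" if "n \<in> {..N}" for n
      unfolding P_def em_rest_cmult using that ReK K by (intro summable_mult em_rest_pw_summable) auto
    have restQ: "em_rest K Q m = 0" for m
      by (simp add: em_rest_def Q_def)
    have constQ: "em_const K Q = c x"
      using K by (simp add: em_const_def restQ) (simp add: Q_def if_distrib cong: if_cong)
    have sPs: "summable (\<lambda>m. em_rest K (\<lambda>j z. \<Sum>n\<le>N. P n j z) (Suc m))"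
      unfolding em_rest_sum[OF finite_atMost] by (intro summable_sum sP)
    have sPT: "summable (\<lambda>m. em_rest K (\<lambda>j z. (\<Sum>n\<le>N. P n j z) + T j z) (Suc m))"
      unfolding em_rest_add by (intro summable_add sPs sT(1))
    have sF: "summable (\<lambda>m. em_rest K F (Suc m))"
      unfolding F_def[abs_def] em_rest_add[of K _ Q] restQ using sPT by simp
    have "em_const K F = em_const K (\<lambda>j z. (\<Sum>n\<le>N. P n j z) + T j z) + em_const K Q"
      unfolding F_def[abs_def] by (intro em_const_add sPT) (simp add: restQ)
    also have "em_const K (\<lambda>j z. (\<Sum>n\<le>N. P n j z) + T j z) = em_const K (\<lambda>j z. \<Sum>n\<le>N. P n j z) + em_const K T"
      by (intro em_const_add sPs sT(1))
    also have "em_const K (\<lambda>j z. \<Sum>n\<le>N. P n j z) = (\<Sum>n\<le>N. em_const K (P n))"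
      by (intro em_const_sum sP) auto
    also have "\<dots> = (\<Sum>n\<le>N. (- of_real x) ^ n / fact n * zconst (w + of_real a * of_nat n))"
    proof (intro sum.cong refl)
      fix n assume "n \<in> {..N}"
      hence "Re (w + of_real a * of_nat n) < real K" using ReK by simp
      thus "em_const K (P n) = (- of_real x) ^ n / fact n * zconst (w + of_real a * of_nat n)"
        unfolding P_def[abs_def] using K by (simp only: em_const_cmult em_rest_pw_summable em_const_pw)
    qed
    finally have constF: "em_const K F = c x + (\<Sum>n\<le>N. (- of_real x) ^ n / fact n * zconst (w + of_real a * of_nat n)) + em_const K T"
      by (simp add: constQ)

    have lim_nat: "filterlim (\<lambda>T. real (Suc T)) at_top sequentially"
      by (rule filterlim_compose[OF filterlim_real_sequentially filterlim_Suc])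
    have F_pos: "F j (of_real t) = of_real t powr (w - of_nat j) * eser (dcoeff w (of_real a) j) (of_real (x * t powr a))"
      if "j > 0" "t > 0" for j t
      using head_plus_tail[OF a that(2), where N = N and x = x and w = w and j = j] that(1)
      unfolding F_def P_def T_def Q_def by simp
    have F0: "(\<lambda>m. F j (of_nat (Suc m))) \<longlonglongrightarrow> 0" for j
    proof -
      have "((\<lambda>t. F j (of_real t)) \<longlongrightarrow> 0) at_top"
      proof (cases "j = 0")
        case True
        have "((\<lambda>t. ((\<Sum>n\<le>N. P n 0 (of_real t)) + T 0 (of_real t)) + (- c x)) \<longlongrightarrow> c x + (- c x)) at_top"
          unfolding P_def T_def by (intro tendsto_add tendsto_const lim x)
        thus ?thesis using True by (simp add: F_def Q_def)
      next
        case False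
        obtain p where p: "\<And>u. eser (dcoeff w (of_real a) j) u = poly p u * exp (- u)"
          using eser_dcoeff_poly_exp[of "of_real a" j w] a False by auto
        have "((\<lambda>t. of_real t powr (w - of_nat j) * (poly p (of_real (x * t powr a)) * exp (- of_real (x * t powr a)))) \<longlongrightarrow> (0::complex)) at_top"
          by (rule poly_exp_tendsto_0[OF a x(1)])
        moreover have "eventually (\<lambda>t. of_real t powr (w - of_nat j) * (poly p (of_real (x * t powr a)) * exp (- of_real (x * t powr a)))
            = F j (of_real t)) at_top"
          using eventually_gt_at_top[of 0] by eventually_elim (use False in \<open>simp only: F_pos p\<close>)
        ultimately show ?thesis by (rule Lim_transform_eventually)
      qed
      from filterlim_compose[OF this lim_nat] show ?thesis by simp
    qed
    have "(\<lambda>M. ((\<Sum>k<M. F 1 (of_nat (Suc k))) - (\<Sum>j<K. em_coeff j * F j (of_nat (Suc M))))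
             + (\<Sum>j<K. em_coeff j * F j (of_nat (Suc M)))) \<longlonglongrightarrow> em_const K F + (\<Sum>j<K. em_coeff j * 0)"
      by (intro tendsto_add tendsto_sum tendsto_mult_left F0 em_const_LIMSEQ sF)
    hence "(\<lambda>k. F 1 (of_nat (Suc k))) sums em_const K F"
      by (simp add: sums_def)
    moreover have "F 1 (of_nat (Suc k)) = complex_of_real (exp (- (real (Suc k) powr a) * x)) / of_nat (Suc k) powr (1 - w)" for k
    proof -
      have "dcoeff w (of_real a) 1 = (\<lambda>_. 1)" by (simp add: fun_eq_iff)
      hence "F 1 (of_real (real (Suc k))) = of_real (real (Suc k)) powr (w - 1) * exp (- of_real (x * real (Suc k) powr a))"
        using F_pos[of 1 "real (Suc k)"] by (simp only: eser_1) simp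
      also have "exp (- complex_of_real (x * real (Suc k) powr a)) = of_real (exp (- (real (Suc k) powr a) * x))"
        by (simp add: exp_of_real [symmetric] mult.commute)
      also have "complex_of_real (real (Suc k)) powr (w - 1) = 1 / of_nat (Suc k) powr (1 - w)"
        using powr_minus_divide[of "of_nat (Suc k) :: complex" "1 - w"] by simp
      finally show ?thesis by simp
    qed
    ultimately have H: "exp_dirichlet_series a (1 - w) x = em_const K F"
      unfolding exp_dirichlet_series_def by (simp only: sums_iff)

    have "norm (em_const K T) \<le> norm (\<Sum>n. em_rest K T (Suc n)) + norm (\<Sum>j<K. em_coeff j * T j 1)"
      unfolding em_const_def by (rule norm_triangle_ineq4)
    moreover have "norm (\<Sum>j<K. em_coeff j * T j 1) \<le> (\<Sum>j<K. norm (em_coeff j) * (D j * x ^ Suc N))"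
      unfolding T_def norm_mult using x
      by (intro sum_norm_le) (simp only: norm_mult, intro mult_left_mono D, auto)
    moreover have "norm (\<Sum>n. em_rest K T (Suc n)) \<le> em_bound K * (C1 * x ^ Suc N) * S"
      unfolding S_def by (rule sT(2))
    moreover have "C * x ^ Suc N = em_bound K * (C1 * x ^ Suc N) * S + (\<Sum>j<K. norm (em_coeff j) * (D j * x ^ Suc N))"
      unfolding C_def distrib_right sum_distrib_right by (simp only: mult_ac)
    ultimately have "norm (em_const K T) \<le> C * x ^ Suc N"
      by linarith
    thus "norm (exp_dirichlet_series a (1 - w) x - (c x + (\<Sum>n\<le>N. (- of_real x) ^ n / fact n * zconst (w + of_real a * of_nat n))))
       \<le> C * x ^ Suc N"
      unfolding H constF by simp
  qed
qed

text \<open>With s = w / a and u = x t^a the primitive is x^(-s) / a times (\<open>lgam s u\<close>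
  minus \<open>gamma_res s\<close> ln x): the logarithm in \<open>lgam\<close> is ln u = ln x + a ln
  t, while the head contains only ln t.\<close>

lemma head_plus_tail_tendsto:
  assumes a: "a > 0" and x: "x > 0" and N: "\<And>n. n > N \<Longrightarrow> w + of_real a * of_nat n \<noteq> 0"
    and L: "((\<lambda>u. lgam (w / of_real a) (of_real u)) \<longlongrightarrow> L) at_top"
  shows "((\<lambda>t. (\<Sum>n\<le>N. (- of_real x) ^ n / fact n * pw (w + of_real a * of_nat n) 0 (of_real t)) + tail w a N x 0 (of_real t))
    \<longlongrightarrow> of_real x powr (- w / of_real a) / of_real a * (L - gamma_res (w / of_real a) * of_real (ln x))) at_top"
proof -
  define s where "s = w / complex_of_real a"
  have w: "w = of_real a * s" using a by (simp add: s_def)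
  \<comment> \<open>Applied with p = x^(-s), q = x^s, r = t^w, e the series, g the resonant sum, l =
    ln x and m = ln t.\<close>
  have cancel: "p / of_real a * (q * r * (of_real a * e) + q * g * (l + of_real a * m) - q * g * l) = r * e + g * m"
    if "p * q = 1" for p q r e g l m :: complex
  proof -
    have "p / of_real a * (q * r * (of_real a * e) + q * g * (l + of_real a * m) - q * g * l)
        = (p * q) * (r * e + g * m)"
      using a by (simp add: field_simps)
    thus ?thesis using that by simp
  qed
  have "filterlim (\<lambda>t. x * t powr a) at_top at_top"
    using a x by real_asymp
  from filterlim_compose[OF L this]
  have "((\<lambda>t. of_real x powr (- s) / of_real a * (lgam s (of_real (x * t powr a)) - gamma_res s * of_real (ln x)))
     \<longlongrightarrow> of_real x powr (- s) / of_real a * (L - gamma_res s * of_real (ln x))) at_top"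
    unfolding s_def [symmetric] by (intro tendsto_intros)
  moreover have "eventually (\<lambda>t. of_real x powr (- s) / of_real a * (lgam s (of_real (x * t powr a)) - gamma_res s * of_real (ln x))
     = (\<Sum>n\<le>N. (- of_real x) ^ n / fact n * pw (w + of_real a * of_nat n) 0 (of_real t)) + tail w a N x 0 (of_real t)) at_top"
    using eventually_gt_at_top[of 0]
  proof eventually_elim
    case t: (elim t)
    define u where "u = x * t powr a"
    have u: "u > 0" "ln u = ln x + a * ln t"
      using x t by (simp_all add: u_def ln_mult ln_powr)
    have us: "complex_of_real u powr s = of_real x powr s * of_real t powr w"
      using u x t by (simp add: powr_def Ln_of_real w exp_add [symmetric] algebra_simps)
    have Lnu: "Ln (complex_of_real u) = of_real (ln x) + of_real a * of_real (ln t)"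
      using u by (simp add: Ln_of_real)
    have "dcoeff s 1 0 = (\<lambda>n. of_real a * dcoeff w (of_real a) 0 n)"
      using a by (auto simp: dcoeff_def w fun_eq_iff distrib_left [symmetric])
    hence E: "eser (dcoeff s 1 0) (of_real u) = of_real a * eser (dcoeff w (of_real a) 0) (of_real u)"
      using a by (simp add: eser_cmult exp_bounded_dcoeff)
    have "{n. n \<le> N \<and> w + of_real a * of_nat n = 0} = {n. s + of_nat n = 0}"
    proof -
      have "w + of_real a * of_nat n = of_real a * (s + of_nat n)" for n
        by (simp add: w distrib_left)
      thus ?thesis using N a by (auto simp: not_le[symmetric])
    qed
    moreover have "gamma_res s = of_real x powr s * (\<Sum>n\<in>{n. s + of_nat n = 0}. (- of_real x) ^ n / fact n)"
      using gamma_res_sum[OF x] by simp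
    ultimately have G: "gamma_res s = of_real x powr s * (\<Sum>n\<in>{n. n \<le> N \<and> w + of_real a * of_nat n = 0}. (- of_real x) ^ n / fact n)"
      by simp
    have xs: "of_real x powr (- s) * of_real x powr s = (1 :: complex)"
      using x by (simp add: powr_minus)
    show ?case
      unfolding head_plus_tail[OF a t] u_def[symmetric] lgam_def us Lnu E G cancel[OF xs] by simp
  qed
  ultimately have "((\<lambda>t. (\<Sum>n\<le>N. (- of_real x) ^ n / fact n * pw (w + of_real a * of_nat n) 0 (of_real t)) + tail w a N x 0 (of_real t))
      \<longlongrightarrow> of_real x powr (- s) / of_real a * (L - gamma_res s * of_real (ln x))) at_top"
    by (rule Lim_transform_eventually)
  moreover have "- w / of_real a = - s" by (simp add: s_def)
  ultimately show ?thesis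
    unfolding s_def [symmetric] by (simp only:)
qed

text \<open>The previous bound needs N at or beyond any resonant index. Taking N = Max A achieves
  this, and the indices of {..N} outside A exceed M, so their terms go into the error.\<close>

lemma exp_dirichlet_series_expansion:
  assumes a: "a > 0" and L: "((\<lambda>u. lgam (w / of_real a) (of_real u)) \<longlongrightarrow> L) at_top"
    and A: "{..M} \<subseteq> A" "finite A" "\<And>n. w + of_real a * of_nat n = 0 \<Longrightarrow> n \<in> A"
  shows "\<exists>C. \<forall>x. 0 < x \<longrightarrow> x \<le> 1 \<longrightarrow>
     norm (exp_dirichlet_series a (1 - w) x
        - (of_real x powr (- w / of_real a) / of_real a * (L - gamma_res (w / of_real a) * of_real (ln x))
         + (\<Sum>n\<in>A. (- of_real x) ^ n / fact n * zconst (w + of_real a * of_nat n))))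
       \<le> C * x ^ Suc M"
proof -
  define N where "N = Max A"
  have AN: "A \<subseteq> {..N}" using A by (auto simp: N_def)
  have MN: "M \<le> N" using A AN by auto
  have N: "w + of_real a * of_nat n \<noteq> 0" if "n > N" for n
    using A(3)[of n] AN that by auto
  define c where "c x = of_real x powr (- w / of_real a) / of_real a * (L - gamma_res (w / of_real a) * of_real (ln x))" for x
  define g where "g x n = (- complex_of_real x) ^ n / fact n * zconst (w + of_real a * of_nat n)" for x n
  obtain C where C: "\<And>x. 0 < x \<Longrightarrow> x \<le> 1 \<Longrightarrow>
     norm (exp_dirichlet_series a (1 - w) x - (c x + (\<Sum>n\<le>N. g x n))) \<le> C * x ^ Suc N"
    using exp_dirichlet_series_bound[OF a N head_plus_tail_tendsto[OF a _ N L]] unfolding c_def g_def by blast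
  define D where "D = \<bar>C\<bar> + (\<Sum>n\<in>{..N} - A. norm (zconst (w + of_real a * of_nat n)))"
  have "norm (exp_dirichlet_series a (1 - w) x - (c x + (\<Sum>n\<in>A. g x n))) \<le> D * x ^ Suc M" if x: "0 < x" "x \<le> 1" for x
  proof -
    have "(\<Sum>n\<le>N. g x n) = (\<Sum>n\<in>A. g x n) + (\<Sum>n\<in>{..N} - A. g x n)"
      using AN by (subst add.commute, intro sum.subset_diff) auto
    hence "exp_dirichlet_series a (1 - w) x - (c x + (\<Sum>n\<in>A. g x n))
       = (exp_dirichlet_series a (1 - w) x - (c x + (\<Sum>n\<le>N. g x n))) + (\<Sum>n\<in>{..N} - A. g x n)"
      by simp
    hence "norm (exp_dirichlet_series a (1 - w) x - (c x + (\<Sum>n\<in>A. g x n)))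
       \<le> norm (exp_dirichlet_series a (1 - w) x - (c x + (\<Sum>n\<le>N. g x n))) + norm (\<Sum>n\<in>{..N} - A. g x n)"
      by (simp only: norm_triangle_ineq)
    also have "norm (\<Sum>n\<in>{..N} - A. g x n) \<le> (\<Sum>n\<in>{..N} - A. norm (zconst (w + of_real a * of_nat n)) * x ^ Suc M)"
    proof (intro sum_norm_le)
      fix n assume "n \<in> {..N} - A"
      hence "Suc M \<le> n" using A(1) by (auto simp: not_le subset_iff Suc_le_eq)
      hence "x ^ n \<le> x ^ Suc M" using x by (intro power_decreasing) auto
      moreover have "x ^ n / fact n \<le> x ^ n"
        using x by (simp add: divide_le_eq)
      ultimately have "x ^ n / fact n * norm (zconst (w + of_real a * of_nat n)) \<le> x ^ Suc M * norm (zconst (w + of_real a * of_nat n))"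
        by (intro mult_right_mono) auto
      thus "norm (g x n) \<le> norm (zconst (w + of_real a * of_nat n)) * x ^ Suc M"
        using x by (simp add: g_def norm_mult norm_divide norm_power mult.commute)
    qed
    also have "norm (exp_dirichlet_series a (1 - w) x - (c x + (\<Sum>n\<le>N. g x n))) \<le> \<bar>C\<bar> * x ^ Suc M"
    proof -
      have "C * x ^ Suc N \<le> \<bar>C\<bar> * x ^ Suc M"
        using x MN power_decreasing[of "Suc M" "Suc N" x] by (intro mult_mono) auto
      thus ?thesis using C[OF x] by linarith
    qed
    finally show ?thesis by (simp only: D_def distrib_right sum_distrib_right)
  qed
  thus ?thesis unfolding c_def g_def by blast
qed

lemma smallo_power_at_right_0:
  assumes "\<And>x. 0 < x \<Longrightarrow> x \<le> 1 \<Longrightarrow> norm (f x) \<le> C * x ^ Suc N"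
  shows "f \<in> o[at_right 0](\<lambda>x. complex_of_real x ^ N)"
proof (rule landau_o.smallI)
  fix c :: real assume c: "c > 0"
  \<comment> \<open>Ensures C x <= c; the summand 1 avoids a zero denominator.\<close>
  define d where "d = min 1 (c / (\<bar>C\<bar> + 1))"
  have d: "d > 0" using c by (simp add: d_def)
  have "eventually (\<lambda>x. x \<in> {0<..<d}) (at_right 0)"
    using d by (rule eventually_at_right_real)
  thus "eventually (\<lambda>x. norm (f x) \<le> c * norm (complex_of_real x ^ N)) (at_right 0)"
  proof eventually_elim
    case (elim x)
    hence x: "0 < x" "x \<le> 1" "x \<le> c / (\<bar>C\<bar> + 1)" by (auto simp: d_def)
    have "x * (\<bar>C\<bar> + 1) \<le> c"
      using x(3) by (subst (asm) pos_le_divide_eq) auto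
    moreover have "C * x \<le> x * (\<bar>C\<bar> + 1)"
    proof -
      have "C * x \<le> \<bar>C\<bar> * x" using x by (intro mult_right_mono) auto
      moreover have "x * (\<bar>C\<bar> + 1) = \<bar>C\<bar> * x + x" by (simp add: algebra_simps)
      ultimately show ?thesis using x by linarith
    qed
    ultimately have "C * x \<le> c" by linarith
    hence "C * x * x ^ N \<le> c * x ^ N"
      using x by (intro mult_right_mono) simp_all
    moreover have "norm (f x) \<le> C * x * x ^ N" using assms[of x] x by (simp add: mult.assoc)
    moreover have "norm (complex_of_real x ^ N) = x ^ N" using x by (simp add: norm_power)
    ultimately show ?case by (metis order_trans)
  qed
qed


lemma exp_dirichlet_series_1_1:
  assumes x: "x > 0"
  shows "exp_dirichlet_series 1 1 x = of_real (- ln (1 - exp (- x)))"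
proof -
  have "(\<lambda>n. - ((- (- exp (- x))) ^ n) / real n) sums ln (1 + - exp (- x))"
    by (rule ln_series') (use x in simp)
  hence "(\<lambda>n. - (- (exp (- x) ^ n / real n))) sums - ln (1 - exp (- x))"
    by (intro sums_minus) simp
  \<comment> \<open>The term n = 0 is 0 by division by zero, so dropping it keeps the sum.\<close>
  hence "(\<lambda>n. exp (- x) ^ Suc n / real (Suc n)) sums - ln (1 - exp (- x))"
    by (subst sums_Suc_iff) simp
  hence "(\<lambda>n. complex_of_real (exp (- x) ^ Suc n / real (Suc n))) sums of_real (- ln (1 - exp (- x)))"
    by (rule sums_of_real)
  moreover have "complex_of_real (exp (- x) ^ Suc n / real (Suc n))
      = complex_of_real (exp (- (real (Suc n) powr 1) * x)) / of_nat (Suc n) powr 1" for n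
  proof -
    have "exp (- x) ^ Suc n = exp (- (real (Suc n) powr 1) * x)"
      unfolding exp_of_nat_mult [symmetric] by (simp add: algebra_simps)
    moreover have "complex_of_nat (Suc n) powr 1 = of_nat (Suc n)"
      by (simp add: powr_def exp_of_real del: of_nat_Suc)
    ultimately show ?thesis by simp
  qed
  ultimately show ?thesis
    unfolding exp_dirichlet_series_def by (simp only: sums_iff)
qed

text \<open>The value of the limit is read off from the case \<open>a = b = 1\<close>, where the series is elementary.\<close>
lemma lgam_0_tendsto: "((\<lambda>u. lgam 0 (of_real u)) \<longlongrightarrow> - euler_mascheroni) at_top"
proof -
  obtain L where L: "((\<lambda>u. lgam 0 (of_real u)) \<longlongrightarrow> L) at_top"
    using lgam_0_convergent by blast
  \<comment> \<open>By the expansion h tends to L plus Euler's constant as x tends to 0, while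
    elementary asymptotics give 0.\<close>
  define h where "h x = - ln (1 - exp (- x)) + ln x" for x :: real
  obtain C where C: "\<And>x. 0 < x \<Longrightarrow> x \<le> 1 \<Longrightarrow> norm (of_real (h x) - (L + euler_mascheroni)) \<le> C * x"
  proof -
    have g0: "gamma_res 0 = 1" using gamma_res_of_nat[of 0] by simp
    have "\<exists>C. \<forall>x. 0 < x \<longrightarrow> x \<le> 1 \<longrightarrow>
       norm (exp_dirichlet_series 1 (1 - 0) x
          - (of_real x powr (- 0 / of_real 1) / of_real 1 * (L - gamma_res (0 / of_real 1) * of_real (ln x))
           + (\<Sum>n\<in>{0}. (- of_real x) ^ n / fact n * zconst (0 + of_real 1 * of_nat n))))
         \<le> C * x ^ Suc 0"
      by (rule exp_dirichlet_series_expansion) (use L in auto)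
    then obtain C where C: "\<And>x. 0 < x \<Longrightarrow> x \<le> 1 \<Longrightarrow>
       norm (exp_dirichlet_series 1 (1 - 0) x
          - (of_real x powr (- 0 / of_real 1) / of_real 1 * (L - gamma_res (0 / of_real 1) * of_real (ln x))
           + (\<Sum>n\<in>{0}. (- of_real x) ^ n / fact n * zconst (0 + of_real 1 * of_nat n))))
         \<le> C * x ^ Suc 0"
      by blast
    show ?thesis
    proof (rule that)
      fix x :: real assume x: "0 < x" "x \<le> 1"
      have "exp_dirichlet_series 1 (1 - 0) x
          - (of_real x powr (- 0 / of_real 1) / of_real 1 * (L - gamma_res (0 / of_real 1) * of_real (ln x))
           + (\<Sum>n\<in>{0}. (- of_real x) ^ n / fact n * zconst (0 + of_real 1 * of_nat n)))
        = of_real (h x) - (L + euler_mascheroni)"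
        using x by (simp add: exp_dirichlet_series_1_1 g0 zconst_def h_def)
      thus "norm (of_real (h x) - (L + euler_mascheroni)) \<le> C * x"
        using C[OF x] by simp
    qed
  qed
  have "((\<lambda>x. C * x) \<longlongrightarrow> C * 0) (at_right 0)"
    by (intro tendsto_intros)
  hence lim: "((\<lambda>x. C * x) \<longlongrightarrow> 0) (at_right 0)"
    by simp
  have "eventually (\<lambda>x. norm (of_real (h x) - (L + euler_mascheroni)) \<le> C * x) (at_right 0)"
    using eventually_at_right_real[of 0 1] by (auto elim!: eventually_mono intro: C)
  hence "((\<lambda>x. of_real (h x) - (L + euler_mascheroni)) \<longlongrightarrow> 0) (at_right 0)"
    by (rule Lim_null_comparison) (rule lim)
  hence "((\<lambda>x. complex_of_real (h x)) \<longlongrightarrow> L + euler_mascheroni) (at_right 0)"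
    by (rule LIM_zero_cancel)
  moreover have "(h \<longlongrightarrow> 0) (at_right 0)"
    unfolding h_def by real_asymp
  hence "((\<lambda>x. complex_of_real (h x)) \<longlongrightarrow> of_real 0) (at_right 0)"
    by (rule tendsto_of_real)
  ultimately have "L + euler_mascheroni = of_real 0"
    by (intro tendsto_unique[OF trivial_limit_at_right_real])
  hence "L = - euler_mascheroni"
    by (simp add: add_eq_0_iff2)
  thus ?thesis using L by simp
qed

theorem corollary2:
  fixes a :: real and b :: complex
  assumes "a > 0"
  shows
    "((\<forall>n::nat. b \<noteq> 1 + complex_of_real a * of_nat n) \<longrightarrow>
       (\<forall>N::nat.
         (\<lambda>x::real. exp_dirichlet_series a b x
             - (complex_of_real x powr ((b - 1) / complex_of_real a) / complex_of_real a
                  * Gamma ((1 - b) / complex_of_real a)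
                + (\<Sum>n\<le>N. (- complex_of_real x) ^ n / fact n
                     * riemann_zeta (b - complex_of_real a * of_nat n))))
           \<in> o[at_right 0](\<lambda>x. complex_of_real x ^ N)))
     \<and>
     (\<forall>n\<^sub>0::nat. b = 1 + complex_of_real a * of_nat n\<^sub>0 \<longrightarrow>
       (\<forall>N::nat.
         (\<lambda>x::real. exp_dirichlet_series a b x
             - ((- complex_of_real x) ^ n\<^sub>0
                  * (euler_mascheroni * complex_of_real a + Digamma (of_nat n\<^sub>0 + 1)
                     - complex_of_real (ln x))
                  / (complex_of_real a * fact n\<^sub>0)
                + (\<Sum>n\<in>{..N} - {n\<^sub>0}. (- complex_of_real x) ^ n / fact n
                     * riemann_zeta (b - complex_of_real a * of_nat n))))
           \<in> o[at_right 0](\<lambda>x. complex_of_real x ^ N)))"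
proof -
  have a0: "complex_of_real a \<noteq> 0" using assms by simp
  have zc: "zconst (1 - b + of_real a * of_nat n) = riemann_zeta (b - of_real a * of_nat n)"
    if "1 - b + of_real a * of_nat n \<noteq> 0" for n
  proof -
    have "1 - (1 - b + of_real a * of_nat n) = b - of_real a * of_nat n" by simp
    thus ?thesis using that by (simp only: zconst_def if_False)
  qed
  show ?thesis
  proof (intro conjI allI impI)
    fix N assume b: "\<forall>n::nat. b \<noteq> 1 + complex_of_real a * of_nat n"
    have nz: "1 - b + of_real a * of_nat n \<noteq> 0" for n
      using b[rule_format, of n] by (auto simp: algebra_simps)
    have s: "(1 - b) / of_real a \<notin> \<int>\<^sub>\<le>\<^sub>0"
    proof
      assume "(1 - b) / of_real a \<in> \<int>\<^sub>\<le>\<^sub>0"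
      then obtain n where "(1 - b) / of_real a = - of_nat n" by (elim nonpos_Ints_cases')
      thus False using nz[of n] a0 by (simp add: divide_eq_eq algebra_simps)
    qed
    obtain C where C: "\<And>x. 0 < x \<Longrightarrow> x \<le> 1 \<Longrightarrow> norm (exp_dirichlet_series a (1 - (1 - b)) x
        - (of_real x powr (- (1 - b) / of_real a) / of_real a
             * (Gamma ((1 - b) / of_real a) - gamma_res ((1 - b) / of_real a) * of_real (ln x))
         + (\<Sum>n\<le>N. (- of_real x) ^ n / fact n * zconst (1 - b + of_real a * of_nat n)))) \<le> C * x ^ Suc N"
      using exp_dirichlet_series_expansion[OF assms lgam_tendsto_Gamma[OF s], of N "{..N}"] nz by auto
    show "(\<lambda>x::real. exp_dirichlet_series a b x
             - (complex_of_real x powr ((b - 1) / complex_of_real a) / complex_of_real a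
                  * Gamma ((1 - b) / complex_of_real a)
                + (\<Sum>n\<le>N. (- complex_of_real x) ^ n / fact n
                     * riemann_zeta (b - complex_of_real a * of_nat n))))
           \<in> o[at_right 0](\<lambda>x. complex_of_real x ^ N)"
      by (rule smallo_power_at_right_0) (use C in \<open>simp add: zc[OF nz] gamma_res_0[OF s]\<close>)
  next
    fix n\<^sub>0 N :: nat assume b: "b = 1 + complex_of_real a * of_nat n\<^sub>0"
    have s: "(1 - b) / of_real a = - of_nat n\<^sub>0" "- (1 - b) / of_real a = of_nat n\<^sub>0"
      using a0 by (simp_all add: b)
    have iff: "1 - b + of_real a * of_nat n = 0 \<longleftrightarrow> n = n\<^sub>0" for n
      using a0 by (simp add: b)
    \<comment> \<open>Inserting \<open>n\<^sub>0\<close> keeps its term even when it exceeds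
      N.\<close>
    obtain C where C: "\<And>x. 0 < x \<Longrightarrow> x \<le> 1 \<Longrightarrow> norm (exp_dirichlet_series a (1 - (1 - b)) x
        - (of_real x powr of_nat n\<^sub>0 / of_real a
             * ((-1) ^ n\<^sub>0 / fact n\<^sub>0 * Digamma (of_nat n\<^sub>0 + 1) - gamma_res (- of_nat n\<^sub>0) * of_real (ln x))
         + (\<Sum>n\<in>insert n\<^sub>0 {..N}. (- of_real x) ^ n / fact n * zconst (1 - b + of_real a * of_nat n)))) \<le> C * x ^ Suc N"
      using exp_dirichlet_series_expansion[OF assms, of "1 - b" _ N "insert n\<^sub>0 {..N}", unfolded s iff,
          OF lgam_tendsto_Digamma[OF lgam_0_tendsto]] by auto
    show "(\<lambda>x::real. exp_dirichlet_series a b x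
             - ((- complex_of_real x) ^ n\<^sub>0
                  * (euler_mascheroni * complex_of_real a + Digamma (of_nat n\<^sub>0 + 1)
                     - complex_of_real (ln x))
                  / (complex_of_real a * fact n\<^sub>0)
                + (\<Sum>n\<in>{..N} - {n\<^sub>0}. (- complex_of_real x) ^ n / fact n
                     * riemann_zeta (b - complex_of_real a * of_nat n))))
           \<in> o[at_right 0](\<lambda>x. complex_of_real x ^ N)"
    proof (rule smallo_power_at_right_0)
      fix x :: real assume x: "0 < x" "x \<le> 1"
      \<comment> \<open>At \<open>n\<^sub>0\<close> the argument of \<open>zconst\<close> is 0; this
        yields the summand with Euler's constant.\<close>
      have "(\<Sum>n\<in>insert n\<^sub>0 {..N}. (- of_real x) ^ n / fact n * zconst (1 - b + of_real a * of_nat n))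
          = (- of_real x) ^ n\<^sub>0 / fact n\<^sub>0 * euler_mascheroni
            + (\<Sum>n\<in>{..N} - {n\<^sub>0}. (- of_real x) ^ n / fact n * zconst (1 - b + of_real a * of_nat n))"
        by (subst sum.insert_remove) (use iff[of n\<^sub>0] in \<open>simp_all add: zconst_def\<close>)
      also have "(\<Sum>n\<in>{..N} - {n\<^sub>0}. (- of_real x) ^ n / fact n * zconst (1 - b + of_real a * of_nat n))
          = (\<Sum>n\<in>{..N} - {n\<^sub>0}. (- of_real x) ^ n / fact n * riemann_zeta (b - of_real a * of_nat n))"
        using iff zc by (intro sum.cong refl) simp
      finally have sum: "(\<Sum>n\<in>insert n\<^sub>0 {..N}. (- of_real x) ^ n / fact n * zconst (1 - b + of_real a * of_nat n))
          = (- of_real x) ^ n\<^sub>0 / fact n\<^sub>0 * euler_mascheroni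
            + (\<Sum>n\<in>{..N} - {n\<^sub>0}. (- of_real x) ^ n / fact n * riemann_zeta (b - of_real a * of_nat n))" .
      have pow: "complex_of_real x powr of_nat n\<^sub>0 = of_real x ^ n\<^sub>0"
        using x by (simp add: powr_nat')
      have main: "of_real x ^ n\<^sub>0 / of_real a * ((-1) ^ n\<^sub>0 / fact n\<^sub>0 * Digamma (of_nat n\<^sub>0 + 1) - (-1) ^ n\<^sub>0 / fact n\<^sub>0 * of_real (ln x))
           + ((- of_real x) ^ n\<^sub>0 / fact n\<^sub>0 * euler_mascheroni + R)
         = (- complex_of_real x) ^ n\<^sub>0 * (euler_mascheroni * complex_of_real a + Digamma (of_nat n\<^sub>0 + 1) - complex_of_real (ln x))
             / (complex_of_real a * fact n\<^sub>0) + R" for R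
        using a0 by (simp add: power_minus[of "of_real x"] field_simps)
      show "norm (exp_dirichlet_series a b x
             - ((- complex_of_real x) ^ n\<^sub>0
                  * (euler_mascheroni * complex_of_real a + Digamma (of_nat n\<^sub>0 + 1)
                     - complex_of_real (ln x))
                  / (complex_of_real a * fact n\<^sub>0)
                + (\<Sum>n\<in>{..N} - {n\<^sub>0}. (- complex_of_real x) ^ n / fact n
                     * riemann_zeta (b - complex_of_real a * of_nat n)))) \<le> C * x ^ Suc N"
        using C[OF x] unfolding sum pow gamma_res_of_nat main by simp
    qed
  qed
qed

end
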